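(* $$1\text{-}\mathsf{GEN}\le_{\mathrm W}(1-* )\text{-}\mathsf{WWKL}'.$$
   Context: Represented spaces and Weihrauch reducibility. The symbol $\subseteq$ in front of a domain means "possibly partial". A represented space $(X,\delta_X)$ is a set $X$ with a surjective partial map $\delta_X:\subseteq\mathbb N^{\mathbb N}\to X$. A multi-valued function $f:\subseteq X\rightrightarrows Y$ assigns to each $x\in\mathrm{dom}(f)$ a nonempty set $f(x)\subseteq Y$. A realizer $F\vdash f$ is a partial function $F:\subseteq\mathbb N^{\mathbb N}\to\mathbb N^{\mathbb N}$ with $\delta_YF(p)\in f(\delta_X(p))$ for all $p\in\mathrm{dom}(f\delta_X)$. $f\le_{\mathrm W}g$: there are computable $K,H:\subseteq\mathbb N^{\mathbb N}\to\mathbb N^{\mathbb N}$ with $H\langle\mathrm{id},GK\rangle\vdash f$ for all $G\vdash g$, where $\langle p,q\rangle(2k)=p(k)$, $\langle p,q\rangle(2k+1)=q(k)$. With $\langle p_0,p_1,\dots\rangle(\langle i,j\rangle):=p_i(j)$, $X^{\mathbb N}$ is represented by $\delta_X^{\mathbb N}\langle p_0,p_1,\dots\rangle:=(\delta_X(p_i))_i$. Points of $2^{\mathbb N}$ name themselves; coproducts $\bigsqcup_nX_n=\bigcup_n(\{n\}\times X_n)$ carry the canonical representation. Jump. $\lim:\subseteq\mathbb N^{\mathbb N}\to\mathbb N^{\mathbb N}$, $\langle p_0,p_1,\dots\rangle\mapsto\lim_np_n$ (product topology). The jump $f'$ of $f:\subseteq(X,\delta_X)\rightrightarrows(Y,\delta_Y)$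 is the same multi-valued function with input representation replaced by $\delta_X\circ\lim$. Genericity. For $q\in2^{\mathbb N}$ let $U_i^q:=\{p\in2^{\mathbb N}:\varphi_i^{\langle p,q\rangle}(0)\downarrow\}$, where $\varphi_i^r$ is the $i$-th partial function computable with oracle $r$. A point $p\in2^{\mathbb N}$ is 1-generic in $q$ if for all $i$ there is a finite prefix $w$ of $p$ with $w2^{\mathbb N}\subseteq U_i^q$ or $w2^{\mathbb N}\cap U_i^q=\emptyset$. $1\text{-}\mathsf{GEN}:2^{\mathbb N}\rightrightarrows2^{\mathbb N}$ is $1\text{-}\mathsf{GEN}(q):=\{p:p\text{ is 1-generic in }q\}$. Weak weak Kőnig's lemma. $\mathrm{Tr}$ is the set of binary trees $T\subseteq\{0,1\}^*$, represented via characteristic functions; $[T]\subseteq2^{\mathbb N}$ is the set of infinite paths of $T$; $\mu$ is the uniform measure on $2^{\mathbb N}$. For $\varepsilon\in[0,1]$, $\varepsilon\text{-}\mathsf{WWKL}:\subseteq\mathrm{Tr}\rightrightarrows2^{\mathbb N}$, $T\mapsto[T]$, has domain $\{T:\mu([T])>\varepsilon\}$. The problem $(1-* )\text{-}\mathsf{WWKL}$ maps a sequence $(T_n)_{n\in\mathbb N}$ of binary trees with $\mu([T_n])>1-2^{-n}$ for all $n$ to $\bigsqcup_{n=0}^\infty(1-2^{-n})\text{-}\mathsf{WWKL}(T_n)$, i.e., possible outputs are pairs $(n,p)$ with $n\in\mathbb N$ and $p\in[T_n]$. $(1-* )\text{-}\mathsf{WWKL}'$ is its jump. *)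

theory Defs
  imports "HOL-Probability.Probability" "HOL-Library.Nat_Bijection"
begin

section \<open>Computability with an oracle\<close>

type_synonym baire = "nat \<Rightarrow> nat"
type_synonym cantor = "nat \<Rightarrow> bool"

text \<open>
  Oracle programs for partial functions on the naturals: the partial recursive functions relative to
  an oracle, in the unary presentation where several arguments are packed into one by
  \<^const>\<open>prod_encode\<close>.
\<close>

datatype ocode =
    CZero | CSucc | CFst | CSnd | COracle
  | CPair ocode ocode
  | CComp ocode ocode
  | CPrec ocode ocode
  | CMu ocode

primrec ocode_eval :: "ocode \<Rightarrow> baire \<Rightarrow> nat \<rightharpoonup> nat" where
  "ocode_eval CZero r n = Some 0"
| "ocode_eval CSucc r n = Some (Suc n)"
| "ocode_eval CFst r n = Some (fst (prod_decode n))"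
| "ocode_eval CSnd r n = Some (snd (prod_decode n))"
| "ocode_eval COracle r n = Some (r n)"
| "ocode_eval (CPair f g) r n =
     Option.bind (ocode_eval f r n) (\<lambda>a.
     Option.bind (ocode_eval g r n) (\<lambda>b. Some (prod_encode (a, b))))"
| "ocode_eval (CComp f g) r n = Option.bind (ocode_eval g r n) (ocode_eval f r)"
| "ocode_eval (CPrec f g) r n =
     rec_nat (ocode_eval f r (fst (prod_decode n)))
       (\<lambda>k acc. Option.bind acc (\<lambda>y.
          ocode_eval g r (prod_encode (fst (prod_decode n), prod_encode (k, y)))))
       (snd (prod_decode n))"
| "ocode_eval (CMu f) r n =
     (if \<exists>m. ocode_eval f r (prod_encode (n, m)) = Some 0 \<and>
             (\<forall>k<m. ocode_eval f r (prod_encode (n, k)) \<noteq> None)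
      then Some (LEAST m. ocode_eval f r (prod_encode (n, m)) = Some 0)
      else None)"

primrec ocode_index :: "ocode \<Rightarrow> nat" where
  "ocode_index CZero = 0"
| "ocode_index CSucc = 1"
| "ocode_index CFst = 2"
| "ocode_index CSnd = 3"
| "ocode_index COracle = 4"
| "ocode_index (CPair f g) = 5 + 4 * prod_encode (ocode_index f, ocode_index g)"
| "ocode_index (CComp f g) = 6 + 4 * prod_encode (ocode_index f, ocode_index g)"
| "ocode_index (CPrec f g) = 7 + 4 * prod_encode (ocode_index f, ocode_index g)"
| "ocode_index (CMu f) = 8 + 4 * ocode_index f"

lemma inj_ocode_index: "inj ocode_index"
proof (rule injI)
  fix c d :: ocode
  show "ocode_index c = ocode_index d \<Longrightarrow> c = d"
  proof (induction c arbitrary: d)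
    case CZero then show ?case by (cases d) auto
  next
    case CSucc then show ?case by (cases d) auto
  next
    case CFst then show ?case by (cases d) auto
  next
    case CSnd then show ?case by (cases d) auto
  next
    case COracle then show ?case by (cases d) auto
  next
    case (CPair f g) then show ?case by (cases d) (auto, presburger+)
  next
    case (CComp f g) then show ?case by (cases d) (auto, presburger+)
  next
    case (CPrec f g) then show ?case by (cases d) (auto, presburger+)
  next
    case (CMu f) then show ?case by (cases d) (auto, presburger+)
  qed
qed

lemma surj_ocode_index: "surj ocode_index"
proof -
  have "\<exists>c. ocode_index c = n" for n
  proof (induction n rule: less_induct)
    case (less n)
    show ?case
    proof (cases "n < 5")
      case True
      then have "n = 0 \<or> n = 1 \<or> n = 2 \<or> n = 3 \<or> n = 4" by auto
      then show ?thesis by (metis ocode_index.simps(1-5))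
    next
      case False
      define k where "k = (n - 5) div 4"
      obtain a b where ab: "prod_encode (a, b) = k"
        by (metis prod_decode_inverse surj_pair)
      have "k < n" using False unfolding k_def by linarith
      moreover have "a \<le> k" "b \<le> k" using ab le_prod_encode_1 le_prod_encode_2 by blast+
      ultimately obtain f g h where "ocode_index f = a" "ocode_index g = b" "ocode_index h = k"
        using less.IH by (meson order_le_less_trans)
      then have "ocode_index (CPair f g) = 5 + 4 * k" "ocode_index (CComp f g) = 6 + 4 * k"
        "ocode_index (CPrec f g) = 7 + 4 * k" "ocode_index (CMu h) = 8 + 4 * k"
        using ab by simp_all
      moreover have "n = 5 + 4 * k \<or> n = 6 + 4 * k \<or> n = 7 + 4 * k \<or> n = 8 + 4 * k"
        using False unfolding k_def by presburger
      ultimately show ?thesis by metis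
    qed
  qed
  then show ?thesis by (metis surjI)
qed

lemma bij_ocode_index: "bij ocode_index"
  using inj_ocode_index surj_ocode_index by (rule bijI)

definition phi :: "nat \<Rightarrow> baire \<Rightarrow> nat \<rightharpoonup> nat" where
  "phi i = ocode_eval (inv ocode_index i)"

text \<open>The program may behave arbitrarily on oracles outside the domain of the function.\<close>

definition computable_baire :: "(baire \<rightharpoonup> baire) \<Rightarrow> bool" where
  "computable_baire F \<longleftrightarrow> (\<exists>i. \<forall>p q. F p = Some q \<longrightarrow> (\<forall>n. phi i p n = Some (q n)))"


section \<open>Represented spaces and Weihrauch reducibility\<close>

text \<open>
  A represented space is given by its representation \<^term>\<open>\<delta>\<close> alone; the underlying set is
  \<^term>\<open>ran \<delta>\<close>, which makes \<^term>\<open>\<delta>\<close> surjective.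
\<close>

type_synonym 'a representation = "baire \<rightharpoonup> 'a"

text \<open>
  A multi-valued function is a partial map to sets of admissible values, so that its domain is
  explicit. It is bundled with the representations of its source and target.
\<close>

record ('a, 'b) problem =
  in_rep :: "'a representation"
  out_rep :: "'b representation"
  mvfun :: "'a \<rightharpoonup> 'b set"

definition realizes :: "(baire \<rightharpoonup> baire) \<Rightarrow> ('a, 'b) problem \<Rightarrow> bool" (infix "\<turnstile>\<^sub>R" 50) where
  "F \<turnstile>\<^sub>R f \<longleftrightarrow>
     (\<forall>p x S. in_rep f p = Some x \<and> mvfun f x = Some S \<longrightarrow>
        (\<exists>q y. F p = Some q \<and> out_rep f q = Some y \<and> y \<in> S))"

definition baire_pair :: "baire \<Rightarrow> baire \<Rightarrow> baire" where
  "baire_pair p q n = (if even n then p (n div 2) else q (n div 2))"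

definition baire_row :: "baire \<Rightarrow> nat \<Rightarrow> baire" where
  "baire_row p i j = p (prod_encode (i, j))"

definition weihrauch_le :: "('a, 'b) problem \<Rightarrow> ('c, 'd) problem \<Rightarrow> bool" (infix "\<le>\<^sub>W" 50) where
  "f \<le>\<^sub>W g \<longleftrightarrow>
     (\<exists>K H. computable_baire K \<and> computable_baire H \<and>
        (\<forall>G. G \<turnstile>\<^sub>R g \<longrightarrow>
           H \<circ>\<^sub>m (\<lambda>p. map_option (baire_pair p) ((G \<circ>\<^sub>m K) p)) \<turnstile>\<^sub>R f))"

text \<open>Convergence on \<^typ>\<open>baire\<close> is with respect to the product topology.\<close>

definition baire_lim :: "baire \<rightharpoonup> baire" where
  "baire_lim p =
     (if \<exists>q. baire_row p \<longlonglongrightarrow> q then Some (THE q. baire_row p \<longlonglongrightarrow> q) else None)"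

lemma baire_lim_eq_Some_iff: "baire_lim p = Some q \<longleftrightarrow> baire_row p \<longlonglongrightarrow> q"
proof -
  have unique: "q = r" if "baire_row p \<longlonglongrightarrow> q" "baire_row p \<longlonglongrightarrow> r" for q r
  proof
    fix j
    have *: "(\<lambda>n. baire_row p n j) \<longlonglongrightarrow> s j" if "baire_row p \<longlonglongrightarrow> s" for s
      using continuous_on_tendsto_compose[OF continuous_on_product_coordinates[of j] that] by simp
    show "q j = r j" using *[OF that(1)] *[OF that(2)] by (rule LIMSEQ_unique)
  qed
  show ?thesis
  proof
    assume "baire_row p \<longlonglongrightarrow> q"
    moreover from this have "(THE q. baire_row p \<longlonglongrightarrow> q) = q"
      using unique by (intro the_equality)
    ultimately show "baire_lim p = Some q" unfolding baire_lim_def by metis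
  next
    assume "baire_lim p = Some q"
    then obtain r where r: "baire_row p \<longlonglongrightarrow> r" and q: "(THE q. baire_row p \<longlonglongrightarrow> q) = q"
      unfolding baire_lim_def by (metis option.distinct(1) option.inject)
    from r have "(THE q. baire_row p \<longlonglongrightarrow> q) = r"
      using unique by (intro the_equality)
    with r q show "baire_row p \<longlonglongrightarrow> q" by simp
  qed
qed

definition jump :: "('a, 'b) problem \<Rightarrow> ('a, 'b) problem" where
  "jump f = f\<lparr>in_rep := in_rep f \<circ>\<^sub>m baire_lim\<rparr>"

definition seq_rep :: "'a representation \<Rightarrow> (nat \<Rightarrow> 'a) representation" where
  "seq_rep \<delta> p =
     (if \<forall>i. baire_row p i \<in> dom \<delta> then Some (\<lambda>i. the (\<delta> (baire_row p i))) else None)"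

text \<open>A name of \<open>(n, x)\<close> is the number \<open>n\<close> followed by a name of \<open>x\<close> in the \<open>n\<close>-th space.\<close>

definition coproduct_rep :: "(nat \<Rightarrow> 'a representation) \<Rightarrow> (nat \<times> 'a) representation" where
  "coproduct_rep \<delta> p = map_option (Pair (p 0)) (\<delta> (p 0) (p \<circ> Suc))"

definition cantor_name :: "cantor \<Rightarrow> baire" where
  "cantor_name x = (\<lambda>n. of_bool (x n))"

definition cantor_rep :: "cantor representation" where
  "cantor_rep p = (if range p \<subseteq> {0, 1} then Some (\<lambda>n. p n = 1) else None)"


section \<open>Genericity\<close>

definition cylinder :: "bool list \<Rightarrow> cantor set" where
  "cylinder w = {x. map x [0..<length w] = w}"

definition sigma1_set :: "nat \<Rightarrow> cantor \<Rightarrow> cantor set" where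
  "sigma1_set i q = {p. phi i (baire_pair (cantor_name p) (cantor_name q)) 0 \<noteq> None}"

definition one_generic_in :: "cantor \<Rightarrow> cantor \<Rightarrow> bool" where
  "one_generic_in p q \<longleftrightarrow>
     (\<forall>i. \<exists>w. p \<in> cylinder w \<and>
        (cylinder w \<subseteq> sigma1_set i q \<or> cylinder w \<inter> sigma1_set i q = {}))"

definition one_GEN :: "(cantor, cantor) problem" where
  "one_GEN = \<lparr>in_rep = cantor_rep, out_rep = cantor_rep,
              mvfun = (\<lambda>q. Some {p. one_generic_in p q})\<rparr>"


section \<open>Weak weak Koenig's lemma\<close>

definition binary_tree :: "bool list set \<Rightarrow> bool" where
  "binary_tree T \<longleftrightarrow> (\<forall>v w. v @ w \<in> T \<longrightarrow> v \<in> T)"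

text \<open>The position of a word in the length-lexicographic order.\<close>

definition word_index :: "bool list \<Rightarrow> nat" where
  "word_index w = foldl (\<lambda>n b. 2 * n + 1 + of_bool b) 0 w"

lemma word_index_snoc: "word_index (w @ [b]) = 2 * word_index w + 1 + of_bool b"
  by (simp add: word_index_def)

lemma bij_word_index: "bij word_index"
proof (rule bijI)
  show "inj word_index"
  proof (rule injI)
    fix v w :: "bool list"
    show "word_index v = word_index w \<Longrightarrow> v = w"
    proof (induction v arbitrary: w rule: rev_induct)
      case Nil
      then show ?case
        by (cases w rule: rev_cases) (simp_all add: word_index_snoc, simp add: word_index_def)
    next
      case (snoc b v)
      show ?case
      proof (cases w rule: rev_cases)
        case Nil
        with snoc.prems show ?thesis
          by (simp add: word_index_snoc) (simp add: word_index_def)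
      next
        case (snoc u c)
        have eq: "2 * word_index v + of_bool b = 2 * word_index u + (of_bool c :: nat)"
          using snoc.prems \<open>w = u @ [c]\<close> by (simp add: word_index_snoc)
        then have "b = c" by (cases b; cases c; simp; presburger)
        with eq snoc.IH \<open>w = u @ [c]\<close> show ?thesis by simp
      qed
    qed
  qed
next
  have "\<exists>w. word_index w = n" for n
  proof (induction n rule: less_induct)
    case (less n)
    show ?case
    proof (cases "n = 0")
      case True
      then have "word_index [] = n" by (simp add: word_index_def)
      then show ?thesis ..
    next
      case False
      then have "(n - 1) div 2 < n" by linarith
      then obtain w where "word_index w = (n - 1) div 2" using less.IH by blast
      then have "word_index (w @ [even n]) = n"
        using False by (simp add: word_index_snoc) presburger
      then show ?thesis ..
    qed
  qed
  then show "surj word_index" by (metis surjI)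
qed

text \<open>Trees are named by their characteristic functions, words being identified with numbers.\<close>

definition tree_rep :: "bool list set representation" where
  "tree_rep p =
     (let T = {w. p (word_index w) = 1}
      in if range p \<subseteq> {0, 1} \<and> binary_tree T then Some T else None)"

definition tree_paths :: "bool list set \<Rightarrow> cantor set" where
  "tree_paths T = {x. \<forall>n. map x [0..<n] \<in> T}"

definition cantor_measure :: "cantor measure" where
  "cantor_measure = PiM UNIV (\<lambda>_. uniform_count_measure UNIV)"

definition eps_WWKL :: "real \<Rightarrow> (bool list set, cantor) problem" where
  "eps_WWKL \<epsilon> = \<lparr>in_rep = tree_rep, out_rep = cantor_rep,
     mvfun = (\<lambda>T. if binary_tree T \<and> measure cantor_measure (tree_paths T) > \<epsilon>
                  then Some (tree_paths T) else None)\<rparr>"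

definition one_minus_star_WWKL :: "(nat \<Rightarrow> bool list set, nat \<times> cantor) problem" where
  "one_minus_star_WWKL =
     \<lparr>in_rep = seq_rep tree_rep, out_rep = coproduct_rep (\<lambda>_. cantor_rep),
      mvfun = (\<lambda>T. if \<forall>n. T n \<in> dom (mvfun (eps_WWKL (1 - 1 / 2 ^ n)))
                   then Some (SIGMA n:UNIV. the (mvfun (eps_WWKL (1 - 1 / 2 ^ n)) (T n)))
                   else None)\<rparr>"

end

theory Submission
  imports Defs
begin

text \<open>
  A probabilistic algorithm (a ``fireworks'' argument) computes a 1-generic with error probability
  less than \<open>2\<^sup>-\<^sup>n\<close>, and its failures can be recognised in the limit, so that the random
  sequences on which it succeeds are the paths of a limit computable tree.

  The algorithm builds a point from longer and longer finite conditions, and takes care of each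
  requirement \<open>i\<close> (``a prefix lies inside \<open>U\<^sub>i\<close>, or no extension of it meets \<open>U\<^sub>i\<close>'') infinitely
  often, where \<open>U\<^sub>i\<close> is \<open>sigma1_set i q\<close>. Which alternative holds is undecidable. By default the algorithm guesses that
  the present condition has no extension in \<open>U\<^sub>i\<close>, and goes on. A wrong guess is eventually refuted;
  it is then replaced by the same guess about the present, longer condition, and the refutations are
  counted. Before the run, a threshold \<open>k\<^sub>i < 2\<^sup>n\<^sup>+\<^sup>i\<^sup>+\<^sup>2\<close> is read off the random sequence. When
  a refutation occurs after exactly \<open>k\<^sub>i\<close> earlier ones, the algorithm bets on the opposite: it waits
  for an extension of the present condition inside \<open>U\<^sub>i\<close> and moves there. If this search never gets
  stuck, then every requirement is met (\<open>one_generic_if_never_stuck\<close>): either the bet was placed and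
  won, or the count stays bounded and the last guess is right.

  The search for \<open>i\<close> can only get stuck if the condition at that moment has no extension in
  \<open>U\<^sub>i\<close>. A run with a larger threshold, all other random bits being the same, makes a guess about
  this very condition, which is never refuted. So at most one value of \<open>k\<^sub>i\<close> is fatal
  (\<open>stuck_unique\<close>), failure at \<open>i\<close> has probability at most \<open>2\<^sup>-\<^sup>n\<^sup>-\<^sup>i\<^sup>-\<^sup>2\<close>, and the total failure
  probability is at most \<open>2\<^sup>-\<^sup>n\<^sup>-\<^sup>1\<close> (\<open>measure_never_stuck\<close>).

  Let \<open>T\<^sub>n\<close> consist of the words \<open>w\<close> for which the run with random bits \<open>w\<close> does not get stuck in its
  first \<open>|w|\<close> stages; the paths of \<open>T\<^sub>n\<close> are the sequences on which the algorithm succeeds. If every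
  search is cut off after \<open>t\<close> steps, membership in \<open>T\<^sub>n\<close> becomes decidable, and for \<open>t \<rightarrow> \<infinity>\<close> these
  approximations converge to \<open>T\<^sub>n\<close>, which is what the jump asks for. From \<open>(n, x)\<close> with \<open>x \<in> [T\<^sub>n]\<close>, the
  algorithm run on \<open>x\<close> computes the 1-generic point.

  Computability is established for concrete oracle programs: total functions are treated by closure
  rules, and the uniform search for elements of the \<open>U\<^sub>i\<close> rests on a normal form theorem
  (\<open>phi_halts_iff\<close>) with a decidable predicate and a built-in bound on the use of the oracle.
\<close>


section \<open>Total functions computable with an oracle\<close>
abbreviation lft :: "nat \<Rightarrow> nat" where "lft z \<equiv> fst (prod_decode z)"
abbreviation rgt :: "nat \<Rightarrow> nat" where "rgt z \<equiv> snd (prod_decode z)"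
abbreviation pair_code :: "nat \<Rightarrow> nat \<Rightarrow> nat" ("\<langle>_,/ _\<rangle>") where
  "\<langle>a, b\<rangle> \<equiv> prod_encode (a, b)"

text \<open>
  The closure rules collected in \<open>recursive_intros\<close> have conclusions of the form
  \<open>recursive (\<lambda>r z. \<dots>)\<close> that are higher-order patterns, so that \<open>intro recursive_intros\<close> follows the
  syntax of a term. Where an operator binds further variables, its rule packs them together with
  \<open>z\<close> into one argument \<open>y\<close>, and they reappear as projections of \<open>y\<close>.
\<close>

definition recursive :: "(baire \<Rightarrow> nat \<Rightarrow> nat) \<Rightarrow> bool" where
  "recursive f \<longleftrightarrow> (\<exists>c. \<forall>r z. ocode_eval c r z = Some (f r z))"

definition decidable :: "(baire \<Rightarrow> nat \<Rightarrow> bool) \<Rightarrow> bool" where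
  "decidable P \<longleftrightarrow> recursive (\<lambda>r z. of_bool (P r z))"

named_theorems recursive_intros

lemma recursive_of_bool [recursive_intros]: "decidable P \<Longrightarrow> recursive (\<lambda>r z. of_bool (P r z))"
  by (simp add: decidable_def)

lemma recursiveI: "(\<And>r z. ocode_eval c r z = Some (f r z)) \<Longrightarrow> recursive f"
  unfolding recursive_def by blast

lemma recursiveE:
  assumes "recursive f" obtains c where "\<And>r z. ocode_eval c r z = Some (f r z)"
  using assms unfolding recursive_def by blast

lemma recursive_app:
  assumes "recursive f" "recursive g" shows "recursive (\<lambda>r z. f r (g r z))"
proof -
  from assms obtain c d where "\<And>r z. ocode_eval c r z = Some (f r z)"
    "\<And>r z. ocode_eval d r z = Some (g r z)" by (elim recursiveE) blast
  then show ?thesis by (intro recursiveI[of "CComp c d"]) simp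
qed

lemma recursive_pair [recursive_intros]:
  assumes "recursive f" "recursive g" shows "recursive (\<lambda>r z. \<langle>f r z, g r z\<rangle>)"
proof -
  from assms obtain c d where "\<And>r z. ocode_eval c r z = Some (f r z)"
    "\<And>r z. ocode_eval d r z = Some (g r z)" by (elim recursiveE) blast
  then show ?thesis by (intro recursiveI[of "CPair c d"]) simp
qed

lemma recursive_Suc [recursive_intros]: "recursive f \<Longrightarrow> recursive (\<lambda>r z. Suc (f r z))"
  by (rule recursive_app[OF recursiveI[of CSucc]]) simp_all

lemma recursive_lft [recursive_intros]: "recursive f \<Longrightarrow> recursive (\<lambda>r z. lft (f r z))"
  by (rule recursive_app[OF recursiveI[of CFst]]) simp_all

lemma recursive_rgt [recursive_intros]: "recursive f \<Longrightarrow> recursive (\<lambda>r z. rgt (f r z))"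
  by (rule recursive_app[OF recursiveI[of CSnd]]) simp_all

lemma recursive_oracle [recursive_intros]: "recursive f \<Longrightarrow> recursive (\<lambda>r z. r (f r z))"
  by (rule recursive_app[OF recursiveI[of COracle]]) simp_all

lemma recursive_id [recursive_intros]: "recursive (\<lambda>r z. z)"
  by (rule recursiveI[of "CPair CFst CSnd"]) simp

lemma recursive_const [recursive_intros]: "recursive (\<lambda>r z. k)"
proof (induction k)
  case 0
  show ?case by (rule recursiveI[of CZero]) simp
qed (rule recursive_Suc)

lemma recursive_app2:
  assumes f: "recursive (\<lambda>r y. f r (lft y) (rgt y))" and "recursive a" "recursive b"
  shows "recursive (\<lambda>r z. f r (a r z) (b r z))"
  using recursive_app[OF f recursive_pair[OF assms(2,3)]] by simp

lemma recursive_rec_nat [recursive_intros]: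
  assumes f: "recursive f" and g: "recursive (\<lambda>r y. g r (lft y) (lft (rgt y)) (rgt (rgt y)))" and h: "recursive h"
  shows "recursive (\<lambda>r z. rec_nat (f r z) (\<lambda>k acc. g r z k acc) (h r z))"
proof -
  obtain c d where c: "\<And>r z. ocode_eval c r z = Some (f r z)"
    and d: "\<And>r y. ocode_eval d r y = Some (g r (lft y) (lft (rgt y)) (rgt (rgt y)))"
    using f g by (elim recursiveE) blast
  have "ocode_eval (CPrec c d) r y = Some (rec_nat (f r (lft y)) (g r (lft y)) (rgt y))" for r y
  proof -
    have "rec_nat (Some (f r x)) (\<lambda>k acc. Option.bind acc (\<lambda>y. ocode_eval d r \<langle>x, \<langle>k, y\<rangle>\<rangle>)) n
        = Some (rec_nat (f r x) (g r x) n)" for x n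
      by (induction n) (simp_all add: d)
    then show ?thesis by (simp add: c)
  qed
  then have "recursive (\<lambda>r y. rec_nat (f r (lft y)) (g r (lft y)) (rgt y))"
    unfolding recursive_def by blast
  from recursive_app2[OF this recursive_id h] show ?thesis by simp
qed

lemma recursive_add [recursive_intros]:
  assumes "recursive f" "recursive g" shows "recursive (\<lambda>r z. f r z + g r z)"
proof -
  have "x + y = rec_nat x (\<lambda>_ a. Suc a) y" for x y :: nat by (induction y) auto
  then show ?thesis by (simp only:) (intro recursive_intros assms)
qed

lemma recursive_mult [recursive_intros]:
  assumes "recursive f" "recursive g" shows "recursive (\<lambda>r z. f r z * g r z)"
proof -
  have "x * y = rec_nat 0 (\<lambda>_ a. a + x) y" for x y :: nat by (induction y) auto
  then show ?thesis by (simp only:) (intro recursive_intros assms recursive_app[OF assms(1)])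
qed

lemma recursive_power [recursive_intros]:
  assumes "recursive f" "recursive g" shows "recursive (\<lambda>r z. f r z ^ g r z)"
proof -
  have "x ^ y = rec_nat 1 (\<lambda>_ a. a * x) y" for x y :: nat by (induction y) auto
  then show ?thesis by (simp only:) (intro recursive_intros assms recursive_app[OF assms(1)])
qed

lemma recursive_diff [recursive_intros]:
  assumes "recursive f" "recursive g" shows "recursive (\<lambda>r z. f r z - g r z)"
proof -
  have pred: "rec_nat 0 (\<lambda>k _. k) x = x - 1" for x :: nat by (cases x) auto
  have "x - y = rec_nat x (\<lambda>_ a. rec_nat 0 (\<lambda>k _. k) a) y" for x y :: nat
    by (induction y) (auto simp: pred)
  then show ?thesis by (simp only:) (intro recursive_intros assms)
qed

lemma decidable_less [recursive_intros]:
  assumes "recursive f" "recursive g" shows "decidable (\<lambda>r z. f r z < g r z)"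
proof -
  have "of_bool (x < y) = 1 - (1 - (y - x))" for x y :: nat by auto
  then show ?thesis unfolding decidable_def by (simp only:) (intro recursive_intros assms)
qed

lemma decidable_not [recursive_intros]:
  assumes "decidable P" shows "decidable (\<lambda>r z. \<not> P r z)"
proof -
  have "of_bool (\<not> b) = (1::nat) - of_bool b" for b by auto
  then show ?thesis unfolding decidable_def by (simp only:) (intro recursive_intros assms)
qed

lemma decidable_conj [recursive_intros]:
  assumes "decidable P" "decidable Q" shows "decidable (\<lambda>r z. P r z \<and> Q r z)"
  unfolding decidable_def of_bool_conj by (intro recursive_intros assms)

lemma decidable_imp [recursive_intros]:
  assumes "decidable P" "decidable Q" shows "decidable (\<lambda>r z. P r z \<longrightarrow> Q r z)"
proof -
  have "decidable (\<lambda>r z. \<not> (P r z \<and> \<not> Q r z))" by (intro recursive_intros assms)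
  then show ?thesis by simp
qed

lemma decidable_iff [recursive_intros]:
  assumes "decidable P" "decidable Q" shows "decidable (\<lambda>r z. P r z = Q r z)"
  unfolding iff_conv_conj_imp by (intro recursive_intros assms)

lemma decidable_le [recursive_intros]:
  assumes "recursive f" "recursive g" shows "decidable (\<lambda>r z. f r z \<le> g r z)"
  unfolding not_less[symmetric] by (intro recursive_intros assms)

lemma decidable_eq [recursive_intros]:
  assumes "recursive f" "recursive g" shows "decidable (\<lambda>r z. f r z = g r z)"
  unfolding eq_iff by (intro recursive_intros assms)

lemma recursive_if [recursive_intros]:
  assumes "decidable P" "recursive f" "recursive g" shows "recursive (\<lambda>r z. if P r z then f r z else g r z)"
proof -
  have "(if b then x else y) = of_bool b * x + of_bool (\<not> b) * y" for b and x y :: nat by auto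
  then show ?thesis by (simp only:) (intro recursive_intros assms)
qed

lemma decidable_if [recursive_intros]:
  assumes "decidable P" "decidable Q" "decidable R" shows "decidable (\<lambda>r z. if P r z then Q r z else R r z)"
  unfolding if_bool_eq_conj by (intro recursive_intros assms)

definition bounded_least :: "(nat \<Rightarrow> bool) \<Rightarrow> nat \<Rightarrow> nat" where
  "bounded_least P n = (if \<exists>k<n. P k then LEAST k. P k else n)"

text \<open>
  The accumulator stays at the first solution once it has reached it, because it then equals a number
  satisfying \<open>P\<close>; this makes bounded search an instance of primitive recursion.
\<close>

lemma bounded_least_rec: "bounded_least P n = rec_nat 0 (\<lambda>k a. if P a then a else Suc a) n"
proof (induction n)
  case 0
  show ?case by (simp add: bounded_least_def)
next
  case (Suc n)
  show ?case
  proof (cases "\<exists>k<n. P k")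
    case True
    then have "P (LEAST k. P k)" "bounded_least P (Suc n) = (LEAST k. P k)"
      by (auto simp: bounded_least_def intro: LeastI less_SucI)
    with True show ?thesis by (simp flip: Suc) (simp add: bounded_least_def)
  next
    case False
    have "(LEAST k. P k) = n" if "P n"
      using that False by (intro Least_equality) (auto simp: not_less[symmetric])
    with False show ?thesis by (simp flip: Suc) (auto simp: bounded_least_def less_Suc_eq)
  qed
qed

lemma bounded_least_less_iff: "bounded_least P n < n \<longleftrightarrow> (\<exists>k<n. P k)"
  unfolding bounded_least_def by (auto intro: le_less_trans[OF Least_le])

lemma recursive_bounded_least [recursive_intros]:
  assumes P: "decidable (\<lambda>r y. P r (lft y) (rgt y))" and "recursive f"
  shows "recursive (\<lambda>r z. bounded_least (P r z) (f r z))"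
proof -
  have *: "decidable (\<lambda>r y. P r (lft y) (rgt (rgt y)))"
    using recursive_app2[OF P[unfolded decidable_def], of "\<lambda>r. lft" "\<lambda>r y. rgt (rgt y)"]
    unfolding decidable_def by (simp add: recursive_intros)
  show ?thesis unfolding bounded_least_rec by (intro recursive_intros assms *)
qed

lemma decidable_bex [recursive_intros]:
  assumes P: "decidable (\<lambda>r y. P r (lft y) (rgt y))" and "recursive f"
  shows "decidable (\<lambda>r z. \<exists>k<f r z. P r z k)"
  unfolding bounded_least_less_iff[symmetric] by (intro recursive_intros assms)

lemma decidable_ball [recursive_intros]:
  assumes P: "decidable (\<lambda>r y. P r (lft y) (rgt y))" and "recursive f"
  shows "decidable (\<lambda>r z. \<forall>k<f r z. P r z k)"
proof -
  have "decidable (\<lambda>r z. \<not> (\<exists>k<f r z. \<not> P r z k))" by (intro recursive_intros assms)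
  then show ?thesis by simp
qed

lemma recursive_div [recursive_intros]:
  assumes "recursive f" "recursive g" shows "recursive (\<lambda>r z. f r z div g r z)"
proof -
  have "x div y = (if y = 0 then 0 else bounded_least (\<lambda>q. x < Suc q * y) x)" for x y :: nat
  proof (cases "y = 0")
    case False
    have eq: "x < Suc q * y \<longleftrightarrow> x div y \<le> q" for q
      using False by (metis div_less_iff_less_mult less_Suc_eq_le neq0_conv)
    have "(LEAST q. x div y \<le> q) = x div y" by (simp add: Least_equality)
    moreover have "x div y \<le> x" by simp
    ultimately show ?thesis using False unfolding bounded_least_def eq
      by (auto simp: not_le) (metis div_le_dividend le_neq_implies_less less_irrefl)
  qed simp
  then show ?thesis
    by (simp only:) (intro recursive_intros assms recursive_app[OF assms(1)] recursive_app[OF assms(2)])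
qed

lemma recursive_mod [recursive_intros]:
  assumes "recursive f" "recursive g" shows "recursive (\<lambda>r z. f r z mod g r z)"
  unfolding minus_mult_div_eq_mod[symmetric] by (intro recursive_intros assms)

lemma decidable_even [recursive_intros]: "recursive f \<Longrightarrow> decidable (\<lambda>r z. even (f r z))"
  unfolding even_iff_mod_2_eq_zero by (intro recursive_intros)

lemma decidable_bit [recursive_intros]: "recursive f \<Longrightarrow> recursive g \<Longrightarrow> decidable (\<lambda>r z. bit (f r z) (g r z))"
  unfolding bit_iff_odd by (intro recursive_intros)

text \<open>
  The only use of unbounded search: every partial function below is obtained by searching for an
  amount of fuel that suffices, and then evaluating a total function.
\<close>

lemma recursive_Least:
  assumes P: "decidable (\<lambda>r y. P r (lft y) (rgt y))" and f: "recursive (\<lambda>r y. f r (lft y) (rgt y))"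
  obtains c where "\<And>r z. \<exists>m. P r z m \<Longrightarrow> ocode_eval c r z = Some (f r z (LEAST m. P r z m))"
proof -
  have "decidable (\<lambda>r y. \<not> P r (lft y) (rgt y))" by (intro recursive_intros P)
  then obtain c d where c: "\<And>r y. ocode_eval c r y = Some (of_bool (\<not> P r (lft y) (rgt y)))"
    and d: "\<And>r y. ocode_eval d r y = Some (f r (lft y) (rgt y))"
    using f unfolding decidable_def by (elim recursiveE) blast
  have "ocode_eval (CComp d (CPair (CPair CFst CSnd) (CMu c))) r z = Some (f r z (LEAST m. P r z m))"
    if "\<exists>m. P r z m" for r z
    using that by (simp add: c d)
  then show thesis by (rule that)
qed

section \<open>A normal form theorem\<close>

text \<open>
  A halting computation is witnessed by a finite set of facts \<open>(c, n, v)\<close>, each saying that program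
  \<open>c\<close> on input \<open>n\<close> has value \<open>v\<close>, such that every fact follows from others in the set by one
  evaluation rule. A set of facts may be coded by a number whose binary digits are its characteristic
  function.
\<close>

type_synonym fact = "ocode \<times> nat \<times> nat"

fun justified :: "baire \<Rightarrow> fact set \<Rightarrow> fact \<Rightarrow> bool" where
  "justified r D (CZero, n, v) \<longleftrightarrow> v = 0"
| "justified r D (CSucc, n, v) \<longleftrightarrow> v = Suc n"
| "justified r D (CFst, n, v) \<longleftrightarrow> v = lft n"
| "justified r D (CSnd, n, v) \<longleftrightarrow> v = rgt n"
| "justified r D (COracle, n, v) \<longleftrightarrow> v = r n"
| "justified r D (CPair f g, n, v) \<longleftrightarrow> (f, n, lft v) \<in> D \<and> (g, n, rgt v) \<in> D"
| "justified r D (CComp f g, n, v) \<longleftrightarrow> (\<exists>y. (g, n, y) \<in> D \<and> (f, y, v) \<in> D)"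
| "justified r D (CPrec f g, n, v) \<longleftrightarrow>
     (case rgt n of 0 \<Rightarrow> (f, lft n, v) \<in> D
      | Suc k \<Rightarrow> \<exists>y. (CPrec f g, \<langle>lft n, k\<rangle>, y) \<in> D \<and> (g, \<langle>lft n, \<langle>k, y\<rangle>\<rangle>, v) \<in> D)"
| "justified r D (CMu f, n, v) \<longleftrightarrow>
     (f, \<langle>n, v\<rangle>, 0) \<in> D \<and> (\<forall>k<v. \<exists>y. (f, \<langle>n, k\<rangle>, Suc y) \<in> D)"

text \<open>
  A justification refers to subprograms only, or to a smaller value of the recursion variable of
  the same program. So there are no circular justifications, and closed sets are sound although
  their facts are unordered.
\<close>

definition closed_facts :: "baire \<Rightarrow> fact set \<Rightarrow> bool" where
  "closed_facts r D \<longleftrightarrow> (\<forall>x\<in>D. justified r D x)"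

lemma justified_mono: "justified r D x \<Longrightarrow> D \<subseteq> E \<Longrightarrow> justified r E x"
  by (cases "(r, D, x)" rule: justified.cases) (auto split: nat.splits, (blast+)?)

lemma closed_facts_Un: "closed_facts r D \<Longrightarrow> closed_facts r E \<Longrightarrow> closed_facts r (D \<union> E)"
  unfolding closed_facts_def using justified_mono by blast

lemma closed_facts_insert:
  "closed_facts r D \<Longrightarrow> justified r D x \<Longrightarrow> closed_facts r (insert x D)"
  unfolding closed_facts_def using justified_mono by blast

lemma Prec_unfold:
  "ocode_eval (CPrec f g) r n =
     (case rgt n of 0 \<Rightarrow> ocode_eval f r (lft n)
      | Suc k \<Rightarrow> Option.bind (ocode_eval (CPrec f g) r \<langle>lft n, k\<rangle>)
                  (\<lambda>y. ocode_eval g r \<langle>lft n, \<langle>k, y\<rangle>\<rangle>))"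
  by (cases "rgt n") simp_all

lemma closed_facts_sound:
  assumes D: "closed_facts r D"
  shows "(c, n, v) \<in> D \<Longrightarrow> ocode_eval c r n = Some v"
proof (induction c arbitrary: n v)
  case (CPrec f g)
  have "(CPrec f g, n, v) \<in> D \<Longrightarrow> rgt n = k \<Longrightarrow> ocode_eval (CPrec f g) r n = Some v" for k n v
  proof (induction k arbitrary: n v)
    case 0
    from 0(1) D have "justified r D (CPrec f g, n, v)" unfolding closed_facts_def by blast
    with 0 CPrec.IH show ?case by simp
  next
    case (Suc k)
    from Suc(2) D have "justified r D (CPrec f g, n, v)" unfolding closed_facts_def by blast
    with Suc(3) obtain y where "(CPrec f g, \<langle>lft n, k\<rangle>, y) \<in> D" "(g, \<langle>lft n, \<langle>k, y\<rangle>\<rangle>, v) \<in> D"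
      by auto
    then have "ocode_eval (CPrec f g) r \<langle>lft n, k\<rangle> = Some y"
      "ocode_eval g r \<langle>lft n, \<langle>k, y\<rangle>\<rangle> = Some v"
      using Suc.IH[of "\<langle>lft n, k\<rangle>" y] CPrec.IH(2) by (simp_all del: ocode_eval.simps)
    with Suc(3) show ?case unfolding Prec_unfold[of f g r n] by (simp del: ocode_eval.simps)
  qed
  with CPrec.prems show ?case by blast
next
  case (CMu f)
  with D have "justified r D (CMu f, n, v)" unfolding closed_facts_def by blast
  then have v: "(f, \<langle>n, v\<rangle>, 0) \<in> D" and "\<forall>k<v. \<exists>y. (f, \<langle>n, k\<rangle>, Suc y) \<in> D" by auto
  then have zero: "ocode_eval f r \<langle>n, v\<rangle> = Some 0"
    and less: "\<forall>k<v. \<exists>y. ocode_eval f r \<langle>n, k\<rangle> = Some (Suc y)"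
    using CMu.IH by blast+
  have "(LEAST m. ocode_eval f r \<langle>n, m\<rangle> = Some 0) = v"
    using zero less by (intro Least_equality) (auto simp: not_less[symmetric])
  moreover have "\<exists>m. ocode_eval f r \<langle>n, m\<rangle> = Some 0 \<and> (\<forall>k<m. ocode_eval f r \<langle>n, k\<rangle> \<noteq> None)"
    using zero less by (intro exI[of _ v]) auto
  ultimately show ?case by simp
next
  case (CPair f g)
  then have "justified r D (CPair f g, n, v)" using D unfolding closed_facts_def by blast
  with CPair.IH show ?case by auto
next
  case (CComp f g)
  then have "justified r D (CComp f g, n, v)" using D unfolding closed_facts_def by blast
  with CComp.IH show ?case by fastforce
qed (use D in \<open>force simp: closed_facts_def\<close>)+

definition derivable :: "baire \<Rightarrow> fact \<Rightarrow> bool" where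
  "derivable r x \<longleftrightarrow> (\<exists>D. finite D \<and> closed_facts r D \<and> x \<in> D)"

lemma derivable_set:
  assumes "finite X" "\<And>x. x \<in> X \<Longrightarrow> derivable r x"
  obtains D where "finite D" "closed_facts r D" "X \<subseteq> D"
proof -
  have "\<exists>D. finite D \<and> closed_facts r D \<and> X \<subseteq> D"
    using assms
  proof (induction X)
    case empty
    show ?case by (intro exI[of _ "{}"]) (auto simp: closed_facts_def)
  next
    case (insert x X)
    then obtain D where "finite D" "closed_facts r D" "X \<subseteq> D" by blast
    moreover obtain E where "finite E" "closed_facts r E" "x \<in> E"
      using insert.prems[of x] unfolding derivable_def by blast
    ultimately show ?case by (intro exI[of _ "D \<union> E"]) (simp add: closed_facts_Un le_supI1)
  qed
  with that show thesis by blast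
qed

lemma derivable_step:
  assumes "finite X" "\<And>x. x \<in> X \<Longrightarrow> derivable r x" "justified r X x"
  shows "derivable r x"
proof -
  obtain D where D: "finite D" "closed_facts r D" "X \<subseteq> D"
    using assms(1,2) by (rule derivable_set)
  then have "closed_facts r (insert x D)"
    using closed_facts_insert justified_mono[OF assms(3)] by blast
  with D(1) show ?thesis unfolding derivable_def by blast
qed

text \<open>
  Closed sets are stable under unions, so that the finitely many subcomputations which an evaluation step
  refers to can be combined.
\<close>

lemma derivable_complete: "ocode_eval c r n = Some v \<Longrightarrow> derivable r (c, n, v)"
proof (induction c arbitrary: n v)
  case (CPair f g)
  then obtain a b where "v = \<langle>a, b\<rangle>" "derivable r (f, n, a)" "derivable r (g, n, b)"
    by (auto simp: bind_eq_Some_conv)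
  then show ?case by - (rule derivable_step[of "{(f, n, a), (g, n, b)}"]; auto)
next
  case (CComp f g)
  from CComp.prems obtain a where "ocode_eval g r n = Some a" "ocode_eval f r a = Some v"
    by (auto simp: bind_eq_Some_conv)
  then have "derivable r (f, a, v)" "derivable r (g, n, a)"
    using CComp.IH by blast+
  then show ?case by - (rule derivable_step[of "{(f, a, v), (g, n, a)}"]; auto)
next
  case (CPrec f g)
  have "ocode_eval (CPrec f g) r n = Some v \<Longrightarrow> rgt n = k \<Longrightarrow> derivable r (CPrec f g, n, v)" for k n v
  proof (induction k arbitrary: n v)
    case 0
    with CPrec.IH have "derivable r (f, lft n, v)" unfolding Prec_unfold[of f g r n] by simp
    with 0 show ?case by - (rule derivable_step[of "{(f, lft n, v)}"]; auto)
  next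
    case (Suc k)
    from Suc(2,3) obtain y where y: "ocode_eval (CPrec f g) r \<langle>lft n, k\<rangle> = Some y"
      "ocode_eval g r \<langle>lft n, \<langle>k, y\<rangle>\<rangle> = Some v"
      unfolding Prec_unfold[of f g r n] by (auto simp: bind_eq_Some_conv simp del: ocode_eval.simps)
    then have "derivable r (CPrec f g, \<langle>lft n, k\<rangle>, y)" "derivable r (g, \<langle>lft n, \<langle>k, y\<rangle>\<rangle>, v)"
      using Suc.IH[OF y(1)] CPrec.IH by auto
    with Suc(3) show ?case
      by - (rule derivable_step[of "{(CPrec f g, \<langle>lft n, k\<rangle>, y), (g, \<langle>lft n, \<langle>k, y\<rangle>\<rangle>, v)}"]; auto)
  qed
  with CPrec.prems show ?case by blast
next
  case (CMu f)
  let ?P = "\<lambda>m. ocode_eval f r \<langle>n, m\<rangle> = Some 0"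
  obtain m where m: "?P m" "\<forall>k<m. ocode_eval f r \<langle>n, k\<rangle> \<noteq> None" and v: "v = Least ?P"
    using CMu.prems by (auto split: if_splits)
  have "?P v" "v \<le> m" unfolding v using m(1) by (auto intro: LeastI Least_le)
  have "\<exists>y. derivable r (f, \<langle>n, k\<rangle>, Suc y)" if "k < v" for k
  proof -
    have "\<not> ?P k" using that unfolding v by (rule not_less_Least)
    moreover have "ocode_eval f r \<langle>n, k\<rangle> \<noteq> None" using that \<open>v \<le> m\<close> m(2) by auto
    ultimately obtain w where "ocode_eval f r \<langle>n, k\<rangle> = Some w" "w \<noteq> 0" by auto
    then obtain y where "ocode_eval f r \<langle>n, k\<rangle> = Some (Suc y)" by (cases w) auto
    then show ?thesis using CMu.IH by blast
  qed
  then have "\<exists>y. \<forall>k<v. derivable r (f, \<langle>n, k\<rangle>, Suc (y k))"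
    by (intro choice) blast
  then obtain y where y: "\<And>k. k < v \<Longrightarrow> derivable r (f, \<langle>n, k\<rangle>, Suc (y k))" by blast
  show ?case
    by (rule derivable_step[of "insert (f, \<langle>n, v\<rangle>, 0) ((\<lambda>k. (f, \<langle>n, k\<rangle>, Suc (y k))) ` {..<v})"])
      (use y CMu.IH[OF \<open>?P v\<close>] in auto)
qed (rule derivable_step[of "{}"]; simp)+

abbreviation fact_code :: "nat \<Rightarrow> nat \<Rightarrow> nat \<Rightarrow> nat" where
  "fact_code c n v \<equiv> \<langle>c, \<langle>n, v\<rangle>\<rangle>"

definition facts_of :: "nat \<Rightarrow> fact set" where
  "facts_of d = {(c, n, v). bit d (fact_code (ocode_index c) n v)}"

text \<open>
  The numerical counterpart of \<open>justified\<close>, with \<open>c\<close> an index of the program. The quantifiers over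
  intermediate values are bounded by \<open>d\<close>, since every fact recorded in \<open>d\<close> is smaller than \<open>d\<close>.
\<close>

definition justified_code :: "baire \<Rightarrow> nat \<Rightarrow> nat \<Rightarrow> nat \<Rightarrow> nat \<Rightarrow> bool" where
  "justified_code r d c n v \<longleftrightarrow>
    (let k = (c - 5) div 4; f = lft k; g = rgt k in
     if c = 0 then v = 0
     else if c = 1 then v = Suc n
     else if c = 2 then v = lft n
     else if c = 3 then v = rgt n
     else if c = 4 then v = r n
     else if (c - 5) mod 4 = 0 then bit d (fact_code f n (lft v)) \<and> bit d (fact_code g n (rgt v))
     else if (c - 5) mod 4 = 1 then \<exists>y<d. bit d (fact_code g n y) \<and> bit d (fact_code f y v)
     else if (c - 5) mod 4 = 2 then
       if rgt n = 0 then bit d (fact_code f (lft n) v)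
       else \<exists>y<d. bit d (fact_code c \<langle>lft n, rgt n - 1\<rangle> y) \<and>
                  bit d (fact_code g \<langle>lft n, \<langle>rgt n - 1, y\<rangle>\<rangle> v)
     else bit d (fact_code ((c - 8) div 4) \<langle>n, v\<rangle> 0) \<and>
       (\<forall>k<v. \<exists>y<d. bit d (fact_code ((c - 8) div 4) \<langle>n, k\<rangle> (Suc y))))"

lemma bit_nat_less: "bit d x \<Longrightarrow> x < d" for d x :: nat
proof -
  assume "bit d x"
  then have "2 ^ x \<le> d" by (rule contrapos_pp) (simp add: bit_iff_odd)
  then show ?thesis using less_exp[of x] by linarith
qed

lemma fact_code_ge: "n \<le> fact_code c n v" "v \<le> fact_code c n v"
  by (rule order_trans[OF le_prod_encode_1 le_prod_encode_2]
      order_trans[OF le_prod_encode_2 le_prod_encode_2])+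

lemma bit_fact_less: "bit d (fact_code c n v) \<Longrightarrow> n < d" "bit d (fact_code c n v) \<Longrightarrow> v < d"
  using bit_nat_less[of d "fact_code c n v"] fact_code_ge(1)[of n c v] fact_code_ge(2)[of v c n]
  by linarith+

lemma quarter_simps: "Suc (4 * k) div 4 = k" "Suc (Suc (4 * k)) div 4 = k" "Suc (Suc (4 * k)) mod 4 = 2"
  "Suc (4 * k) mod 4 = 1" "(3 + 4 * k) mod 4 = 3"
  for k :: nat
  by presburger+

lemma justified_code: "justified_code r d (ocode_index c) n v = justified r (facts_of d) (c, n, v)"
proof (cases c)
  case (CComp f g)
  then show ?thesis
    by (simp add: justified_code_def facts_of_def Let_def quarter_simps) (use bit_fact_less in blast)
next
  case (CPrec f g)
  then show ?thesis
    by (simp add: justified_code_def facts_of_def Let_def quarter_simps split: nat.split) (use bit_fact_less in blast)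
next
  case (CMu f)
  then show ?thesis
    by (simp add: justified_code_def facts_of_def Let_def quarter_simps) (use bit_fact_less(2) Suc_lessD in blast)
qed (simp_all add: justified_code_def facts_of_def Let_def quarter_simps)

definition halts_by :: "baire \<Rightarrow> nat \<Rightarrow> nat \<Rightarrow> bool" where
  "halts_by r i d \<longleftrightarrow> (\<forall>x<d. bit d x \<longrightarrow> justified_code r d (lft x) (lft (rgt x)) (rgt (rgt x))) \<and>
     (\<exists>v<d. bit d (fact_code i 0 v))"

lemma halts_by_iff:
  "halts_by r i d \<longleftrightarrow> closed_facts r (facts_of d) \<and> (\<exists>v. bit d (fact_code i 0 v))"
proof -
  have "(\<forall>x<d. bit d x \<longrightarrow> justified_code r d (lft x) (lft (rgt x)) (rgt (rgt x))) \<longleftrightarrow>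
        (\<forall>c n v. bit d (fact_code c n v) \<longrightarrow> justified_code r d c n v)"
    (is "?L \<longleftrightarrow> ?R")
  proof
    assume ?L
    show ?R
    proof (intro allI impI)
      fix c n v assume "bit d (fact_code c n v)"
      with \<open>?L\<close> bit_nat_less[OF this] show "justified_code r d c n v" by fastforce
    qed
  next
    assume R: ?R
    show ?L
    proof (intro allI impI)
      fix x assume "bit d x"
      then show "justified_code r d (lft x) (lft (rgt x)) (rgt (rgt x))"
        using R[rule_format, of "lft x" "lft (rgt x)" "rgt (rgt x)"] by simp
    qed
  qed
  also have "\<dots> \<longleftrightarrow> closed_facts r (facts_of d)"
  proof
    assume "\<forall>c n v. bit d (fact_code c n v) \<longrightarrow> justified_code r d c n v"
    then show "closed_facts r (facts_of d)" unfolding closed_facts_def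
      by (auto simp: justified_code[symmetric]) (auto simp: facts_of_def)
  next
    assume *: "closed_facts r (facts_of d)"
    show "\<forall>c n v. bit d (fact_code c n v) \<longrightarrow> justified_code r d c n v"
    proof (intro allI impI)
      fix c n v assume b: "bit d (fact_code c n v)"
      obtain e where c: "c = ocode_index e" using surj_ocode_index by blast
      with b have "(e, n, v) \<in> facts_of d" by (simp add: facts_of_def)
      with * show "justified_code r d c n v" unfolding c justified_code closed_facts_def by blast
    qed
  qed
  finally show ?thesis unfolding halts_by_def using bit_fact_less(2) by blast
qed

theorem phi_halts_iff: "phi i r 0 \<noteq> None \<longleftrightarrow> (\<exists>d. halts_by r i d)"
proof -
  define c where "c = inv ocode_index i"
  have i: "i = ocode_index c" unfolding c_def by (simp add: surj_f_inv_f surj_ocode_index)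
  show ?thesis
  proof
    assume "phi i r 0 \<noteq> None"
    then obtain v where "ocode_eval c r 0 = Some v" unfolding phi_def c_def by blast
    from derivable_complete[OF this] obtain D where
      D: "finite D" "closed_facts r D" "(c, 0, v) \<in> D" unfolding derivable_def by blast
    define X where "X = (\<lambda>(c, n, v). fact_code (ocode_index c) n v) ` D"
    have "finite X" using D(1) unfolding X_def by blast
    then have "bit (set_encode X) x \<longleftrightarrow> x \<in> X" for x
      using set_encode_inverse[of X] by (auto simp: set_decode_def bit_iff_odd)
    moreover have "fact_code (ocode_index c) n v \<in> X \<longleftrightarrow> (c, n, v) \<in> D" for c n v
      unfolding X_def by (force simp: inj_eq[OF inj_ocode_index])
    ultimately have "facts_of (set_encode X) = D"
      unfolding facts_of_def by simp
    with D show "\<exists>d. halts_by r i d" unfolding halts_by_iff i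
      by (intro exI[of _ "set_encode X"]) (auto simp: facts_of_def)
  next
    assume "\<exists>d. halts_by r i d"
    then obtain d v where "closed_facts r (facts_of d)" "(c, 0, v) \<in> facts_of d"
      unfolding halts_by_iff by (auto simp: i facts_of_def)
    from closed_facts_sound[OF this] show "phi i r 0 \<noteq> None" unfolding phi_def c_def by simp
  qed
qed

text \<open>
  Every oracle query recorded in \<open>d\<close> is part of a fact and therefore less than \<open>d\<close>, so \<open>d\<close> also
  bounds the use of the oracle.
\<close>

lemma halts_by_cong:
  assumes "\<And>k. k < d \<Longrightarrow> r k = r' k" shows "halts_by r i d \<longleftrightarrow> halts_by r' i d"
proof -
  have "justified r (facts_of d) x = justified r' (facts_of d) x" if "x \<in> facts_of d" for x
  proof -
    have "r n = r' n" if "(COracle, n, v) \<in> facts_of d" for n v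
      using that bit_fact_less(1) assms unfolding facts_of_def by blast
    then show ?thesis using that by (cases "(r, facts_of d, x)" rule: justified.cases) auto
  qed
  then show ?thesis unfolding halts_by_iff closed_facts_def by auto
qed

lemma decidable_halts_by:
  assumes "recursive (\<lambda>r y. R r (lft y) (rgt y))" "recursive i" "recursive d"
  shows "decidable (\<lambda>r z. halts_by (R r z) (i r z) (d r z))"
proof -
  have R: "recursive (\<lambda>r z. R r (f r z) (g r z))" if "recursive f" "recursive g" for f g
    using recursive_app2[OF assms(1) that] .
  show ?thesis unfolding halts_by_def justified_code_def Let_def
    by (intro recursive_intros R recursive_app[OF assms(2)] recursive_app[OF assms(3)])
qed

section \<open>The fireworks algorithm\<close>

text \<open>
  A condition is a code \<open>\<langle>l, a\<rangle>\<close>. It stands for the word of the first \<open>l\<close> binary digits of \<open>a\<close>, least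
  significant digit first.

  The data of all requirements are kept in one number, read as an infinite array of which almost all
  entries are \<open>0\<close>: the pair \<open>\<langle>x, B\<rangle>\<close> has \<open>x\<close> at position \<open>0\<close>, followed by the array \<open>B\<close>. As
  \<open>\<langle>0, 0\<rangle> = 0\<close>, the number \<open>0\<close> is the array of zeros.
\<close>

definition tail :: "nat \<Rightarrow> nat \<Rightarrow> nat" where
  "tail A k = rec_nat A (\<lambda>_. rgt) k"

definition entry :: "nat \<Rightarrow> nat \<Rightarrow> nat" where
  "entry A i = lft (tail A i)"

definition set_entry :: "nat \<Rightarrow> nat \<Rightarrow> nat \<Rightarrow> nat" where
  "set_entry A i v = rec_nat \<langle>v, tail A (Suc i)\<rangle> (\<lambda>k B. \<langle>entry A (i - Suc k), B\<rangle>) i"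

lemma tail_Suc: "tail A (Suc k) = tail (rgt A) k"
  by (induction k) (simp_all add: tail_def)

lemma entry_pair [simp]: "entry \<langle>x, B\<rangle> 0 = x" "entry \<langle>x, B\<rangle> (Suc j) = entry B j"
  by (simp_all add: entry_def tail_Suc) (simp add: tail_def)

lemma prod_decode_0: "prod_decode 0 = (0, 0)"
  using prod_encode_inverse[of "(0, 0)"] by (simp add: prod_encode_def)

lemma entry_0 [simp]: "entry 0 i = 0"
  unfolding entry_def by (induction i) (simp_all add: tail_Suc prod_decode_0, simp add: tail_def prod_decode_0)

lemma entry_set_entry [simp]: "entry (set_entry A i v) j = (if j = i then v else entry A j)"
proof -
  have shift: "entry (tail A m) j = entry A (m + j)" for m j
    by (induction m arbitrary: A) (simp_all add: entry_def tail_Suc, simp add: tail_def)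
  have "entry (rec_nat \<langle>v, tail A (Suc i)\<rangle> (\<lambda>k B. \<langle>entry A (i - Suc k), B\<rangle>) k) j =
     (if j = k then v else entry A (i - k + j))" if "k \<le> i" for k
    using that
  proof (induction k arbitrary: j)
    case 0
    show ?case by (cases j) (simp_all add: shift)
  next
    case (Suc k)
    then have "i - k = Suc (i - Suc k)" by simp
    with Suc show ?case by (cases j) auto
  qed
  from this[of i] show ?thesis unfolding set_entry_def by simp
qed

definition point :: "nat \<Rightarrow> baire" where
  "point a j = of_bool (bit a j)"

text \<open>
  A number \<open>e = \<langle>a, d\<rangle>\<close> shows that some extension of the condition \<open>\<sigma>\<close> lies inside \<open>U\<^sub>i\<close>: the point with
  the digits of \<open>a\<close> extends \<open>\<sigma>\<close> and belongs to \<open>U\<^sub>i\<close>, and \<open>d\<close> bounds how much of this point matters.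
\<close>

definition witness :: "baire \<Rightarrow> nat \<Rightarrow> nat \<Rightarrow> nat \<Rightarrow> bool" where
  "witness p i \<sigma> e \<longleftrightarrow> (\<forall>j<lft \<sigma>. bit (lft e) j = bit (rgt \<sigma>) j) \<and>
     halts_by (baire_pair (point (lft e)) p) i (rgt e)"

text \<open>
  The new length covers the use \<open>rgt e\<close> of the witness and exceeds the old one. If \<open>a\<close> is the second
  component of \<open>\<sigma>\<close>, then \<open>extend \<sigma> \<langle>a, 0\<rangle>\<close> adds one more digit of \<open>a\<close>.
\<close>

definition extend :: "nat \<Rightarrow> nat \<Rightarrow> nat" where
  "extend \<sigma> e = \<langle>Suc (lft \<sigma> + rgt e), lft e\<rangle>"

text \<open>
  The threshold of requirement \<open>i\<close> is the number whose binary digits are the first \<open>n + i + 2\<close> bits in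
  row \<open>i\<close> of the random sequence, most significant bit first. Different requirements use disjoint rows.
\<close>

definition threshold :: "nat \<Rightarrow> baire \<Rightarrow> nat \<Rightarrow> nat" where
  "threshold n X i = rec_nat 0 (\<lambda>j y. 2 * y + X \<langle>i, j\<rangle>) (n + i + 2)"

text \<open>
  Stage \<open>s = \<langle>i, j\<rangle>\<close> is devoted to requirement \<open>i\<close>, whose array entry holds the number of refutations
  so far and the condition that the present guess is about. The restriction on \<open>j\<close> makes every bit
  of the threshold of \<open>i\<close> occur at a position less than \<open>s\<close>; so the first \<open>s\<close> random bits determine the
  first \<open>s\<close> stages. Searching below \<open>s\<close> makes the test decidable, and every witness is
  found at some later visit to \<open>i\<close>.
\<close>

definition refuted :: "baire \<Rightarrow> nat \<Rightarrow> nat \<Rightarrow> nat \<Rightarrow> bool" where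
  "refuted p n s A \<longleftrightarrow> n + lft s + 2 \<le> rgt s \<and> (\<exists>e<s. witness p (lft s) (rgt (entry A (lft s))) e)"

definition active :: "baire \<Rightarrow> nat \<Rightarrow> baire \<Rightarrow> nat \<Rightarrow> nat \<Rightarrow> bool" where
  "active p n X s A \<longleftrightarrow> refuted p n s A \<and> lft (entry A (lft s)) = threshold n X (lft s)"

text \<open>
  The set \<open>E\<close> of admissible witnesses is \<open>UNIV\<close> for the actual algorithm, and \<open>{..<t}\<close> for its
  decidable approximation with fuel \<open>t\<close>. An unsuccessful search returns \<open>0\<close> as a
  default value; that it failed is recorded by \<open>stuck\<close>.
\<close>

definition search :: "nat set \<Rightarrow> (nat \<Rightarrow> bool) \<Rightarrow> nat" where
  "search E P = (if \<exists>e\<in>E. P e then LEAST e. e \<in> E \<and> P e else 0)"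

text \<open>
  A state \<open>S\<close> pairs the present condition with the array. When a guess is refuted, the next guess
  about the same requirement concerns the condition reached at that moment.
\<close>

definition stage :: "baire \<Rightarrow> nat \<Rightarrow> baire \<Rightarrow> nat set \<Rightarrow> nat \<Rightarrow> nat \<Rightarrow> nat" where
  "stage p n X E s S =
     \<langle>extend (lft S) (if active p n X s (rgt S) then search E (witness p (lft s) (lft S))
                      else \<langle>rgt (lft S), 0\<rangle>),
      if refuted p n s (rgt S)
      then set_entry (rgt S) (lft s) \<langle>Suc (lft (entry (rgt S) (lft s))), lft S\<rangle>
      else rgt S\<rangle>"

definition run :: "baire \<Rightarrow> nat \<Rightarrow> baire \<Rightarrow> nat set \<Rightarrow> nat \<Rightarrow> nat" where
  "run p n X E s = rec_nat 0 (stage p n X E) s"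

definition stuck :: "baire \<Rightarrow> nat \<Rightarrow> baire \<Rightarrow> nat set \<Rightarrow> nat \<Rightarrow> bool" where
  "stuck p n X E s \<longleftrightarrow> active p n X s (rgt (run p n X E s)) \<and>
     \<not> (\<exists>e\<in>E. witness p (lft s) (lft (run p n X E s)) e)"

definition unstuck :: "baire \<Rightarrow> nat \<Rightarrow> baire \<Rightarrow> nat set \<Rightarrow> nat \<Rightarrow> bool" where
  "unstuck p n X E s \<longleftrightarrow> (\<forall>u<s. \<not> stuck p n X E u)"

text \<open>
  With fuel \<open>t\<close> the algorithm is total and uniformly computable in all parameters. The name \<open>p\<close>
  and the random sequence \<open>X\<close> may themselves depend on the oracle and on the argument.
\<close>

lemma recursive_tail [recursive_intros]:
  assumes "recursive f" "recursive g" shows "recursive (\<lambda>r z. tail (f r z) (g r z))"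
  unfolding tail_def by (intro recursive_intros assms)

lemma recursive_entry [recursive_intros]:
  assumes "recursive f" "recursive g" shows "recursive (\<lambda>r z. entry (f r z) (g r z))"
  unfolding entry_def by (intro recursive_intros assms)

lemma recursive_set_entry [recursive_intros]:
  assumes "recursive f" "recursive g" "recursive h"
  shows "recursive (\<lambda>r z. set_entry (f r z) (g r z) (h r z))"
  unfolding set_entry_def
  by (intro recursive_intros assms recursive_app[OF assms(1)] recursive_app[OF assms(2)])

lemma recursive_extend [recursive_intros]:
  assumes "recursive f" "recursive g" shows "recursive (\<lambda>r z. extend (f r z) (g r z))"
  unfolding extend_def by (intro recursive_intros assms)

lemma recursive_baire_pair:
  assumes "recursive (\<lambda>r y. P r (lft y) (rgt y))" "recursive (\<lambda>r y. Q r (lft y) (rgt y))"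
    "recursive f"
  shows "recursive (\<lambda>r z. baire_pair (P r z) (Q r z) (f r z))"
  unfolding baire_pair_def
  by (intro recursive_intros assms recursive_app2[OF assms(1)] recursive_app2[OF assms(2)])

lemma decidable_witness:
  assumes p: "recursive (\<lambda>r y. P r (lft y) (rgt y))" and
    [recursive_intros]: "recursive i" "recursive \<sigma>" "recursive e"
  shows "decidable (\<lambda>r z. witness (P r z) (i r z) (\<sigma> r z) (e r z))"
  unfolding witness_def point_def
  by (intro recursive_intros recursive_app[OF assms(3)] recursive_app[OF assms(4)]
    decidable_halts_by recursive_baire_pair recursive_app2[OF p])

lemma recursive_threshold:
  assumes X: "recursive (\<lambda>r y. X r (lft y) (rgt y))" and "recursive n" "recursive i"
  shows "recursive (\<lambda>r z. threshold (n r z) (X r z) (i r z))"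
  unfolding threshold_def
  by (intro recursive_intros assms recursive_app[OF assms(3)] recursive_app2[OF X])

lemma decidable_refuted:
  assumes p: "recursive (\<lambda>r y. P r (lft y) (rgt y))" and "recursive n" "recursive s" "recursive A"
  shows "decidable (\<lambda>r z. refuted (P r z) (n r z) (s r z) (A r z))"
  unfolding refuted_def
  by (intro recursive_intros assms recursive_app[OF assms(2)] recursive_app[OF assms(3)]
   recursive_app[OF assms(4)] decidable_witness recursive_app2[OF p])

lemma decidable_active:
  assumes p: "recursive (\<lambda>r y. P r (lft y) (rgt y))" and X: "recursive (\<lambda>r y. X r (lft y) (rgt y))"
    and "recursive n" "recursive s" "recursive A"
  shows "decidable (\<lambda>r z. active (P r z) (n r z) (X r z) (s r z) (A r z))"
  unfolding active_def
  by (intro recursive_intros assms decidable_refuted recursive_threshold recursive_app2[OF p]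
   recursive_app2[OF X])

lemma search_lessThan: "search {..<t} P = (if \<exists>e<t. P e then bounded_least P t else 0)"
proof -
  have "(LEAST e. e < t \<and> P e) = (LEAST e. P e)" if "e < t" "P e" for e
  proof (rule Least_equality)
    have "P (LEAST e. P e)" "(LEAST e. P e) \<le> e" using that by (auto intro: LeastI Least_le)
    with that show "(LEAST e. P e) < t \<and> P (LEAST e. P e)" by simp
  qed (simp add: Least_le)
  then show ?thesis unfolding search_def bounded_least_def by auto
qed

lemma recursive_search:
  assumes P: "decidable (\<lambda>r y. P r (lft y) (rgt y))" and "recursive t"
  shows "recursive (\<lambda>r z. search {..<t r z} (P r z))"
  unfolding search_lessThan by (intro recursive_intros assms)

lemma recursive_stage:
  assumes p: "recursive (\<lambda>r y. P r (lft y) (rgt y))" and X: "recursive (\<lambda>r y. X r (lft y) (rgt y))"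
    and "recursive n" "recursive t" "recursive s" "recursive S"
  shows "recursive (\<lambda>r z. stage (P r z) (n r z) (X r z) {..<t r z} (s r z) (S r z))"
  unfolding stage_def
  by (intro recursive_intros assms decidable_active decidable_refuted recursive_search
    decidable_witness recursive_app2[OF p] recursive_app2[OF X] recursive_app[OF assms(5)]
    recursive_app[OF assms(6)])

lemma recursive_run:
  assumes p: "recursive (\<lambda>r y. P r (lft y) (rgt y))" and X: "recursive (\<lambda>r y. X r (lft y) (rgt y))"
    and "recursive n" "recursive t" "recursive s"
  shows "recursive (\<lambda>r z. run (P r z) (n r z) (X r z) {..<t r z} (s r z))"
  unfolding run_def
  by (intro recursive_intros assms recursive_stage recursive_app2[OF p] recursive_app2[OF X]
    recursive_app[OF assms(3)] recursive_app[OF assms(4)] )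

lemma decidable_unstuck:
  assumes p: "recursive (\<lambda>r y. P r (lft y) (rgt y))" and X: "recursive (\<lambda>r y. X r (lft y) (rgt y))"
    and "recursive n" "recursive t" "recursive s"
  shows "decidable (\<lambda>r z. unstuck (P r z) (n r z) (X r z) {..<t r z} (s r z))"
  unfolding unstuck_def stuck_def Bex_def lessThan_iff
  by (intro recursive_intros assms recursive_run decidable_active decidable_witness
    recursive_app2[OF p] recursive_app2[OF X]
    recursive_app[OF assms(3)] recursive_app[OF assms(4)] )

lemma run_0 [simp]: "run p n X E 0 = 0" by (simp add: run_def)
lemma run_Suc: "run p n X E (Suc s) = stage p n X E s (run p n X E s)" by (simp add: run_def)

abbreviation cond where "cond p n X E s \<equiv> lft (run p n X E s)"
abbreviation data where "data p n X E i s \<equiv> entry (rgt (run p n X E s)) i"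

lemma unstuck_0 [simp]: "unstuck p n X E 0" by (simp add: unstuck_def)
lemma unstuck_Suc: "unstuck p n X E (Suc s) \<longleftrightarrow> unstuck p n X E s \<and> \<not> stuck p n X E s"
  by (auto simp: unstuck_def less_Suc_eq)
lemma unstuck_mono: "unstuck p n X E s \<Longrightarrow> u \<le> s \<Longrightarrow> unstuck p n X E u"
  by (auto simp: unstuck_def)

lemma prod_encode_less: "j < k \<Longrightarrow> \<langle>i, j\<rangle> < \<langle>i, k\<rangle>"
proof (induction k)
  case (Suc k)
  have "\<langle>i, k\<rangle> < \<langle>i, Suc k\<rangle>" by (simp add: prod_encode_def)
  with Suc show ?case by (cases "j = k") auto
qed simp

lemma threshold_cong:
  "(\<And>j. j < n + i + 2 \<Longrightarrow> X \<langle>i, j\<rangle> = Y \<langle>i, j\<rangle>) \<Longrightarrow> threshold n X i = threshold n Y i"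
proof -
  assume *: "\<And>j. j < n + i + 2 \<Longrightarrow> X \<langle>i, j\<rangle> = Y \<langle>i, j\<rangle>"
  have "k \<le> n + i + 2 \<Longrightarrow> rec_nat 0 (\<lambda>j y. 2 * y + X \<langle>i, j\<rangle>) k = rec_nat 0 (\<lambda>j y. 2 * y + Y \<langle>i, j\<rangle>) k" for k
    by (induction k) (auto simp: *)
  from this[OF order_refl] show ?thesis unfolding threshold_def .
qed

lemma threshold_inj:
  assumes eq: "threshold n X i = threshold n Y i" and "\<And>m. X m \<le> 1" "\<And>m. Y m \<le> 1"
    and "j < n + i + 2"
  shows "X \<langle>i, j\<rangle> = Y \<langle>i, j\<rangle>"
proof -
  have "rec_nat 0 (\<lambda>j y. 2 * y + X \<langle>i, j\<rangle>) k = rec_nat 0 (\<lambda>j y. 2 * y + Y \<langle>i, j\<rangle>) k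
    \<Longrightarrow> j < k \<Longrightarrow> X \<langle>i, j\<rangle> = Y \<langle>i, j\<rangle>" for k
  proof (induction k)
    case (Suc k)
    have digits: "2 * a + b = 2 * c + d \<Longrightarrow> a = c \<and> b = d" if "b \<le> 1" "d \<le> 1" for a b c d :: nat
      using that by presburger
    from digits[OF assms(2,3)] Suc show ?case by (auto simp: less_Suc_eq)
  qed simp
  with eq \<open>j < n + i + 2\<close> show ?thesis unfolding threshold_def by blast
qed

text \<open>
  Stage \<open>s\<close> consults only the random bits before position \<open>s\<close>. Therefore finite words decide initial
  parts of the run, which makes the trees below well defined and the failure sets measurable.
\<close>

lemma active_cong:
  assumes "\<And>k. k < s \<Longrightarrow> X k = Y k" shows "active p n X s A \<longleftrightarrow> active p n Y s A"
proof -
  have "threshold n X (lft s) = threshold n Y (lft s)" if "n + lft s + 2 \<le> rgt s"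
  proof (rule threshold_cong)
    fix j assume "j < n + lft s + 2"
    then have "\<langle>lft s, j\<rangle> < \<langle>lft s, rgt s\<rangle>" using that by (intro prod_encode_less) simp
    then show "X \<langle>lft s, j\<rangle> = Y \<langle>lft s, j\<rangle>" using assms by simp
  qed
  then show ?thesis unfolding active_def refuted_def by auto
qed

lemma run_cong:
  assumes "\<And>k. k < s \<Longrightarrow> X k = Y k" shows "run p n X E s = run p n Y E s"
proof -
  have "u \<le> s \<Longrightarrow> run p n X E u = run p n Y E u" for u
  proof (induction u)
    case (Suc u)
    have "active p n X u A = active p n Y u A" for A
      using assms Suc.prems by (intro active_cong) simp
    with Suc show ?case by (simp add: run_Suc stage_def)
  qed simp
  then show ?thesis by simp
qed

lemma stuck_cong:
  assumes "\<And>k. k < s \<Longrightarrow> X k = Y k" shows "stuck p n X E s = stuck p n Y E s"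
  unfolding stuck_def using run_cong[of s X Y] active_cong[of s X Y] assms by simp

lemma unstuck_cong:
  assumes "\<And>k. k < s \<Longrightarrow> X k = Y k" shows "unstuck p n X E s = unstuck p n Y E s"
  unfolding unstuck_def using stuck_cong[of _ X Y] assms by (meson less_trans)

lemma search_fuel: "e < t \<Longrightarrow> P e \<Longrightarrow> search {..<t} P = search UNIV P"
  unfolding search_lessThan by (auto simp: search_def bounded_least_def)

text \<open>
  A search that succeeds below \<open>t\<close> finds the same least witness as the unbounded search. So a
  run with fuel \<open>t\<close> that does not get stuck is a run of the actual algorithm, and conversely an
  initial part of a run that does not get stuck needs only finitely much fuel.
\<close>

lemma unstuck_fuel_run:
  "unstuck p n X {..<t} s \<Longrightarrow> run p n X {..<t} s = run p n X UNIV s \<and> unstuck p n X UNIV s"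
proof (induction s)
  case (Suc s)
  then have IH: "run p n X {..<t} s = run p n X UNIV s" "unstuck p n X UNIV s"
    and "\<not> stuck p n X {..<t} s" by (auto simp: unstuck_Suc)
  let ?S = "run p n X UNIV s"
  have *: "\<exists>e<t. witness p (lft s) (lft ?S) e" if "active p n X s (rgt ?S)"
    using that \<open>\<not> stuck p n X {..<t} s\<close> unfolding stuck_def IH(1) by auto
  then have "\<not> stuck p n X UNIV s" unfolding stuck_def by blast
  moreover have "run p n X {..<t} (Suc s) = run p n X UNIV (Suc s)"
  proof (cases "active p n X s (rgt ?S)")
    case True
    with * search_fuel have "search {..<t} (witness p (lft s) (lft ?S)) = search UNIV (witness p (lft s) (lft ?S))"
      by blast
    then show ?thesis unfolding run_Suc IH(1) stage_def by simp
  next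
    case False
    then show ?thesis unfolding run_Suc IH(1) stage_def by simp
  qed
  ultimately show ?case using IH(2) by (simp add: unstuck_Suc)
qed simp

lemma unstuck_fuel:
  "unstuck p n X UNIV s \<Longrightarrow> \<exists>t0. \<forall>t\<ge>t0. unstuck p n X {..<t} s"
proof (induction s)
  case (Suc s)
  then obtain t0 where t0: "\<And>t. t \<ge> t0 \<Longrightarrow> unstuck p n X {..<t} s" and ns: "\<not> stuck p n X UNIV s"
    unfolding unstuck_Suc by blast
  let ?S = "run p n X UNIV s"
  have run: "run p n X {..<t} s = ?S" if "t \<ge> t0" for t using t0[OF that] unstuck_fuel_run by blast
  obtain e where "active p n X s (rgt ?S) \<Longrightarrow> witness p (lft s) (lft ?S) e"
    using ns unfolding stuck_def by blast
  then have "unstuck p n X {..<t} (Suc s)" if "t \<ge> max t0 (Suc e)" for t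
    using that t0[of t] run[of t] by (auto simp: unstuck_Suc stuck_def)
  then show ?case by blast
qed simp

section \<open>Correctness, and the uniqueness of fatal thresholds\<close>
definition matches :: "nat \<Rightarrow> cantor \<Rightarrow> bool" where
  "matches \<sigma> x \<longleftrightarrow> (\<forall>j<lft \<sigma>. x j = bit (rgt \<sigma>) j)"

lemma data_Suc:
  "data p n X E i (Suc s) =
    (if refuted p n s (rgt (run p n X E s)) \<and> i = lft s
     then \<langle>Suc (lft (data p n X E i s)), cond p n X E s\<rangle> else data p n X E i s)"
  by (simp add: run_Suc stage_def)

lemma count_mono: "u \<le> s \<Longrightarrow> lft (data p n X E i u) \<le> lft (data p n X E i s)"
  by (induction s) (auto simp: data_Suc le_Suc_eq)

text \<open>
  Up to the stage \<open>s\<close> at which the run with the smaller threshold gets stuck, neither run places its bet for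
  \<open>i\<close>, so both coincide. At stage \<open>s\<close> the other run only renews its guess; the new guess is about
  a condition without extensions in \<open>U\<^sub>i\<close>, is never refuted, and so the larger threshold is never
  reached.
\<close>

lemma stuck_unique:
  assumes agree: "\<And>i' j. i' \<noteq> i \<Longrightarrow> X \<langle>i', j\<rangle> = Y \<langle>i', j\<rangle>"
    and s: "stuck p n X UNIV s" "lft s = i" and s': "stuck p n Y UNIV s'" "lft s' = i"
    and less: "threshold n X i < threshold n Y i"
  shows False
proof -
  let ?run = "\<lambda>X. run p n X UNIV" and ?data = "\<lambda>X. data p n X UNIV i"
  have count_s: "lft (?data X s) = threshold n X i" and ref: "refuted p n s (rgt (?run X s))"
    and nowit: "\<not> (\<exists>e. witness p i (cond p n X UNIV s) e)"
    using s unfolding stuck_def active_def by auto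
  have count_s': "lft (?data Y s') = threshold n Y i"
    and ref': "\<exists>e. witness p i (rgt (?data Y s')) e"
    using s' unfolding stuck_def active_def refuted_def by auto
  (* Neither run bets on i before stage s: at each refutation the count is below both thresholds. *)
  have same: "u \<le> s \<Longrightarrow> ?run Y u = ?run X u" for u
  proof (induction u)
    case (Suc u)
    then have IH: "?run Y u = ?run X u" and "u < s" by auto
    have "active p n Y u (rgt (?run X u)) \<longleftrightarrow> active p n X u (rgt (?run X u))"
    proof (cases "lft u = i")
      case True
      have "lft (?data X u) < threshold n X i" if "refuted p n u (rgt (?run X u))"
        using that True \<open>u < s\<close> count_mono[of "Suc u" s p n X UNIV i] count_s by (simp add: data_Suc)
      with True less show ?thesis unfolding active_def by auto
    next
      case False
      then have "threshold n X (lft u) = threshold n Y (lft u)" by (intro threshold_cong agree)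
      then show ?thesis unfolding active_def by simp
    qed
    then show ?case by (simp add: run_Suc stage_def IH)
  qed simp
  show False
  proof (cases "s' \<le> s")
    case True
    then show False
      using count_s count_s' same[OF True] count_mono[OF True, of p n X UNIV i] less by simp
  next
    case False
    (* The guess renewed at stage s stands for ever. *)
    have "?data Y (Suc s + k) = \<langle>Suc (threshold n X i), cond p n X UNIV s\<rangle>" for k
    proof (induction k)
      case 0
      show ?case using same[OF order_refl] ref s(2) count_s by (simp add: data_Suc)
    next
      case (Suc k)
      have "\<not> (refuted p n (Suc s + k) (rgt (?run Y (Suc s + k))) \<and> i = lft (Suc s + k))"
        using nowit Suc.IH unfolding refuted_def by auto
      then have "?data Y (Suc (Suc s + k)) = ?data Y (Suc s + k)"
        by (subst data_Suc) (rule if_not_P)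
      with Suc.IH show ?case by simp
    qed
    from this[of "s' - Suc s"] False have "rgt (?data Y s') = cond p n X UNIV s" by simp
    with ref' nowit show False by simp
  qed
qed

lemma sigma1_iff: "x \<in> sigma1_set i q \<longleftrightarrow> (\<exists>d. halts_by (baire_pair (cantor_name x) (cantor_name q)) i d)"
  by (simp add: sigma1_set_def phi_halts_iff del: not_None_eq)

lemma halts_by_prefix:
  assumes "\<And>j. j < d \<Longrightarrow> x j = bit a j"
  shows "halts_by (baire_pair (cantor_name x) p) i d \<longleftrightarrow> halts_by (baire_pair (point a) p) i d"
  by (rule halts_by_cong) (use assms in \<open>auto simp: baire_pair_def cantor_name_def point_def\<close>)

lemma witness_sound:
  assumes "witness (cantor_name q) i \<sigma> e" "matches (extend \<sigma> e) x"
  shows "x \<in> sigma1_set i q"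
proof -
  have "x j = bit (lft e) j" if "j < rgt e" for j
    using assms(2) that by (simp add: matches_def extend_def)
  with assms(1) show ?thesis unfolding sigma1_iff witness_def using halts_by_prefix by blast
qed

text \<open>
  Halting depends on a finite part of the point only, so the point may be replaced by one with
  finitely many nonzero digits.
\<close>

lemma witness_complete:
  assumes "x \<in> sigma1_set i q" "matches \<sigma> x" shows "\<exists>e. witness (cantor_name q) i \<sigma> e"
proof -
  obtain d where d: "halts_by (baire_pair (cantor_name x) (cantor_name q)) i d"
    using assms(1) sigma1_iff by blast
  define B where "B = {j. j < max d (lft \<sigma>) \<and> x j}"
  have "finite B" unfolding B_def by simp
  then have "bit (set_encode B) j \<longleftrightarrow> j \<in> B" for j
    using set_encode_inverse[of B] by (auto simp: set_decode_def bit_iff_odd)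
  then have bits: "bit (set_encode B) j \<longleftrightarrow> x j" if "j < max d (lft \<sigma>)" for j
    using that unfolding B_def by simp
  then have "halts_by (baire_pair (point (set_encode B)) (cantor_name q)) i d"
    using d halts_by_prefix[of d x "set_encode B"] by simp
  moreover have "\<forall>j<lft \<sigma>. bit (set_encode B) j = bit (rgt \<sigma>) j"
    using bits assms(2) unfolding matches_def by simp
  ultimately have "witness (cantor_name q) i \<sigma> \<langle>set_encode B, d\<rangle>" unfolding witness_def by simp
  then show ?thesis by blast
qed

definition generic :: "baire \<Rightarrow> nat \<Rightarrow> baire \<Rightarrow> cantor" where
  "generic p n X j = bit (rgt (cond p n X UNIV (Suc j))) j"

lemma cond_Suc:
  assumes "\<not> stuck p n X UNIV s"
  obtains e where "cond p n X UNIV (Suc s) = extend (cond p n X UNIV s) e"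
    "\<And>j. j < lft (cond p n X UNIV s) \<Longrightarrow> bit (lft e) j = bit (rgt (cond p n X UNIV s)) j"
    "active p n X s (rgt (run p n X UNIV s)) \<Longrightarrow> witness p (lft s) (cond p n X UNIV s) e"
proof (cases "active p n X s (rgt (run p n X UNIV s))")
  case True
  define P where "P = witness p (lft s) (cond p n X UNIV s)"
  from True assms have "\<exists>e. P e" unfolding stuck_def P_def by auto
  then have "P (search UNIV P)" unfolding search_def by (auto intro: LeastI)
  then have w: "witness p (lft s) (cond p n X UNIV s) (search UNIV P)" unfolding P_def .
  show thesis
  proof (rule that)
    show "cond p n X UNIV (Suc s) = extend (cond p n X UNIV s) (search UNIV P)"
      using True by (simp add: run_Suc stage_def P_def)
  qed (use w in \<open>auto simp: witness_def\<close>)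
next
  case False
  show thesis
    by (rule that[of "\<langle>rgt (cond p n X UNIV s), 0\<rangle>"]) (use False in \<open>auto simp: run_Suc stage_def\<close>)
qed

context
  fixes p n X
  assumes never_stuck: "\<And>s. \<not> stuck p n X UNIV s"
begin

lemma cond_length: "s \<le> lft (cond p n X UNIV s)"
proof (induction s)
  case (Suc s)
  obtain e where "cond p n X UNIV (Suc s) = extend (cond p n X UNIV s) e"
    using cond_Suc[OF never_stuck] .
  with Suc show ?case by (simp add: extend_def)
qed simp

lemma cond_mono:
  "u \<le> s \<Longrightarrow> j < lft (cond p n X UNIV u) \<Longrightarrow>
   j < lft (cond p n X UNIV s) \<and> bit (rgt (cond p n X UNIV s)) j = bit (rgt (cond p n X UNIV u)) j"
proof (induction s)
  case (Suc s)
  show ?case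
  proof (cases "u = Suc s")
    case False
    obtain e where "cond p n X UNIV (Suc s) = extend (cond p n X UNIV s) e"
      "\<And>j. j < lft (cond p n X UNIV s) \<Longrightarrow> bit (lft e) j = bit (rgt (cond p n X UNIV s)) j"
      using cond_Suc[OF never_stuck] by blast
    with Suc False show ?thesis by (simp add: extend_def)
  qed (use Suc in simp)
qed simp

lemma matches_generic: "matches (cond p n X UNIV s) (generic p n X)"
  unfolding matches_def
proof (intro allI impI)
  fix j assume j: "j < lft (cond p n X UNIV s)"
  have j': "j < lft (cond p n X UNIV (Suc j))" using cond_length[of "Suc j"] by simp
  show "generic p n X j = bit (rgt (cond p n X UNIV s)) j" unfolding generic_def
    using cond_mono[OF _ j, of "max s (Suc j)"] cond_mono[OF _ j', of "max s (Suc j)"] by simp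
qed

lemma matches_guess: "matches (rgt (data p n X UNIV i s)) (generic p n X)"
proof (induction s)
  case 0
  show ?case by (simp add: matches_def prod_decode_0)
qed (simp add: data_Suc matches_generic)

lemma matches_cylinder: "x \<in> cylinder (map (bit (rgt \<sigma>)) [0..<lft \<sigma>]) \<longleftrightarrow> matches \<sigma> x"
  by (auto simp: cylinder_def matches_def)

text \<open>
  If the bet for \<open>i\<close> is ever placed, it is won and the next condition lies inside \<open>U\<^sub>i\<close>. Otherwise the
  count can never pass the threshold; hence it is eventually constant, and the guess
  standing then is right since a witness against it would be noticed at a later visit.
\<close>

lemma one_generic_if_never_stuck:
  assumes p: "p = cantor_name q" shows "one_generic_in (generic p n X) q"
  unfolding one_generic_in_def
proof
  fix i
  let ?x = "generic p n X" and ?run = "run p n X UNIV" and ?data = "data p n X UNIV i"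
  have "\<exists>\<sigma>. matches \<sigma> ?x \<and>
    ((\<forall>y. matches \<sigma> y \<longrightarrow> y \<in> sigma1_set i q) \<or> (\<forall>y. matches \<sigma> y \<longrightarrow> y \<notin> sigma1_set i q))"
  proof (cases "\<exists>s. lft s = i \<and> active p n X s (rgt (?run s))")
    case True
    then obtain s where s: "lft s = i" "active p n X s (rgt (?run s))" by blast
    obtain e where "cond p n X UNIV (Suc s) = extend (cond p n X UNIV s) e"
      "witness p i (cond p n X UNIV s) e"
      using cond_Suc[OF never_stuck, of s] s by metis
    then have "y \<in> sigma1_set i q" if "matches (cond p n X UNIV (Suc s)) y" for y
      using that witness_sound p by metis
    with matches_generic show ?thesis by blast
  next
    case False
    have bound: "lft (?data s) \<le> threshold n X i" for s
    proof (induction s)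
      case (Suc s)
      have "lft (?data s) \<noteq> threshold n X i" if "refuted p n s (rgt (?run s))" "lft s = i"
        using False that unfolding active_def by blast
      with Suc show ?case by (auto simp: data_Suc)
    qed (simp add: prod_decode_0)
    (* The final value of the count. *)
    define c where "c = Max (range (\<lambda>s. lft (?data s)))"
    have fin: "finite (range (\<lambda>s. lft (?data s)))"
      using bound by (auto intro!: finite_subset[of _ "{..threshold n X i}"])
    then have "c \<in> range (\<lambda>s. lft (?data s))" unfolding c_def by (intro Max_in) auto
    then obtain s0 where s0: "lft (?data s0) = c" by blast
    have le_c: "lft (?data s) \<le> c" for s unfolding c_def using fin by (intro Max_ge) auto
    have final: "\<not> (refuted p n s (rgt (?run s)) \<and> i = lft s)" if "s0 \<le> s" for s
      using le_c[of "Suc s"] count_mono[OF that, of p n X UNIV i] s0 by (auto simp: data_Suc)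
    have const: "?data (s0 + k) = ?data s0" for k
    proof (induction k)
      case (Suc k)
      then show ?case using final[of "s0 + k"] data_Suc[of p n X UNIV "s0 + k" i] by auto
    qed simp
    define \<tau> where "\<tau> = rgt (?data s0)"
    have "\<not> witness p i \<tau> e" for e
    proof
      assume e: "witness p i \<tau> e"
      (* A visit to i after s0 that is late enough for e to be found. *)
      define s where "s = \<langle>i, max s0 (max (Suc e) (n + i + 2))\<rangle>"
      have "max s0 (max (Suc e) (n + i + 2)) \<le> s" unfolding s_def by (rule le_prod_encode_2)
      then have s: "s0 \<le> s" "e < s" by auto
      have "?data s = ?data s0" using const[of "s - s0"] s by simp
      then have "refuted p n s (rgt (?run s))"
        using e s unfolding refuted_def \<tau>_def by (auto simp: s_def)
      then show False using final[OF s(1)] by (simp add: s_def)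
    qed
    then have "y \<notin> sigma1_set i q" if "matches \<tau> y" for y
      using that witness_complete p by blast
    with matches_guess show ?thesis unfolding \<tau>_def by blast
  qed
  then show "\<exists>w. ?x \<in> cylinder w \<and> (cylinder w \<subseteq> sigma1_set i q \<or> cylinder w \<inter> sigma1_set i q = {})"
    unfolding matches_cylinder[symmetric] by blast
qed

end

section \<open>The probability of failure\<close>
definition flip :: "nat set \<Rightarrow> cantor \<Rightarrow> cantor" where
  "flip S x m \<longleftrightarrow> x m \<noteq> (m \<in> S)"

interpretation coins: product_prob_space "\<lambda>_::nat. uniform_count_measure (UNIV::bool set)" UNIV
  by (intro product_prob_spaceI prob_space_uniform_count_measure) auto

lemma space_cantor_measure [simp]: "space cantor_measure = UNIV"
  by (simp add: cantor_measure_def space_PiM space_uniform_count_measure)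

interpretation cantor: prob_space cantor_measure
  unfolding cantor_measure_def by (rule coins.P.prob_space_axioms)

lemma sets_coordinate: "{x. x k = b} \<in> sets cantor_measure"
proof -
  have "(\<lambda>x. x k) \<in> measurable cantor_measure (uniform_count_measure UNIV)"
    unfolding cantor_measure_def by (rule measurable_component_singleton) simp
  then have "(\<lambda>x. x k) -` {b} \<inter> space cantor_measure \<in> sets cantor_measure"
    by (rule measurable_sets) simp
  then show ?thesis by (simp add: vimage_def)
qed

lemma sets_prefix: "{x. P (map x [0..<N])} \<in> sets cantor_measure"
proof -
  have word: "{x. map x [0..<N] = w} \<in> sets cantor_measure" if "length w = N" for w
  proof -
    have "{x. map x [0..<N] = w} = space cantor_measure \<inter> (\<Inter>k\<in>{..<N}. {x. x k = w ! k})"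
      using that by (auto simp: list_eq_iff_nth_eq)
    also have "\<dots> \<in> sets cantor_measure"
      by (cases "N = 0") (auto intro!: sets.finite_INT sets_coordinate
          simp: sets.top[of cantor_measure, simplified])
    finally show ?thesis .
  qed
  have "{x. P (map x [0..<N])} = (\<Union>w\<in>{w. length w = N \<and> P w}. {x. map x [0..<N] = w})"
    by auto
  also have "\<dots> \<in> sets cantor_measure"
  proof (rule sets.finite_UN)
    show "finite {w :: bool list. length w = N \<and> P w}"
      by (rule finite_subset[OF _ finite_lists_length_eq[of UNIV N]]) auto
  qed (use word in auto)
  finally show ?thesis .
qed

lemma distr_flip:
  shows measurable_flip: "flip S \<in> measurable cantor_measure cantor_measure"
    and "distr cantor_measure cantor_measure (flip S) = cantor_measure"
proof -
  have "(\<lambda>x m. x m \<noteq> (m \<in> S)) \<in> measurable cantor_measure cantor_measure"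
    unfolding cantor_measure_def
  proof (rule measurable_PiM_single')
    fix m
    have "(\<lambda>b. b \<noteq> (m \<in> S)) \<in> measurable (uniform_count_measure UNIV) (uniform_count_measure UNIV)"
      by (rule measurableI) (auto simp: space_uniform_count_measure)
    then show "(\<lambda>x. x m \<noteq> (m \<in> S)) \<in> measurable (Pi\<^sub>M UNIV (\<lambda>_. uniform_count_measure UNIV))
       (uniform_count_measure UNIV)"
      by (rule measurable_compose[rotated]) (rule measurable_component_singleton, simp)
  qed (simp add: space_uniform_count_measure)
  then show meas: "flip S \<in> measurable cantor_measure cantor_measure"
    unfolding flip_def[abs_def] .
  show "distr cantor_measure cantor_measure (flip S) = cantor_measure"
    unfolding cantor_measure_def
  proof (rule coins.PiM_eq)
    fix J :: "nat set" and F :: "nat \<Rightarrow> bool set" assume J: "finite J"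
    define F' where "F' j = (\<lambda>b. b \<noteq> (j \<in> S)) -` F j" for j
    let ?emb = "\<lambda>F. prod_emb UNIV (\<lambda>_. uniform_count_measure UNIV) J (Pi\<^sub>E J F)"
    have "?emb F \<in> sets cantor_measure"
      unfolding cantor_measure_def using J by (intro sets_PiM_I) auto
    then have "emeasure (distr cantor_measure cantor_measure (flip S)) (?emb F) =
      emeasure cantor_measure (flip S -` ?emb F)"
      using emeasure_distr[OF meas] by simp
    also have "flip S -` ?emb F = ?emb F'"
      by (auto simp: prod_emb_def F'_def flip_def space_uniform_count_measure Pi_iff)
    also have "emeasure cantor_measure \<dots> = (\<Prod>j\<in>J. emeasure (uniform_count_measure UNIV) (F' j))"
      unfolding cantor_measure_def using J by (intro coins.emeasure_PiM_emb) auto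
    also have "\<dots> = (\<Prod>j\<in>J. emeasure (uniform_count_measure UNIV) (F j))"
    proof (rule prod.cong[OF refl])
      fix j
      have "card (F' j) = card (F j)" unfolding F'_def
        by (rule card_vimage_inj) (auto simp: inj_def surj_def)
      then show "emeasure (uniform_count_measure UNIV) (F' j) = emeasure (uniform_count_measure UNIV) (F j)"
        by (simp add: emeasure_uniform_count_measure)
    qed
    finally show "emeasure (distr (Pi\<^sub>M UNIV (\<lambda>_. uniform_count_measure UNIV))
        (Pi\<^sub>M UNIV (\<lambda>_. uniform_count_measure UNIV)) (flip S)) (?emb F) =
      (\<Prod>j\<in>J. emeasure (uniform_count_measure UNIV) (F j))"
      unfolding cantor_measure_def .
  qed simp
qed

lemma measure_disjoint_flips:
  assumes F: "F \<in> sets cantor_measure" and V: "finite V"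
    and disj: "\<And>S S' x. S \<in> V \<Longrightarrow> S' \<in> V \<Longrightarrow> flip S x \<in> F \<Longrightarrow> flip S' x \<in> F \<Longrightarrow> S = S'"
  shows "real (card V) * measure cantor_measure F \<le> 1"
proof -
  have "measure cantor_measure (flip S -` F) = measure cantor_measure F" for S
    using measure_distr[OF measurable_flip F, of S] by (simp add: distr_flip)
  then have "real (card V) * measure cantor_measure F = (\<Sum>S\<in>V. measure cantor_measure (flip S -` F))"
    by simp
  also have "\<dots> = measure cantor_measure (\<Union>S\<in>V. flip S -` F)"
  proof (rule cantor.finite_measure_finite_Union[symmetric])
    show "(\<lambda>S. flip S -` F) ` V \<subseteq> sets cantor_measure"
      using measurable_sets[OF measurable_flip F] by auto
  qed (use V disj in \<open>auto simp: disjoint_family_on_def\<close>)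
  also have "\<dots> \<le> 1" by simp
  finally show ?thesis .
qed

definition failure :: "baire \<Rightarrow> nat \<Rightarrow> nat \<Rightarrow> cantor set" where
  "failure p n i = {x. \<exists>s. lft s = i \<and> stuck p n (cantor_name x) UNIV s}"

definition pad :: "bool list \<Rightarrow> baire" where
  "pad w j = of_bool (j < length w \<and> w ! j)"

lemma pad_prefix: "j < s \<Longrightarrow> pad (map x [0..<s]) j = cantor_name x j"
  by (simp add: pad_def cantor_name_def)

lemma stuck_pad: "stuck p n (pad (map x [0..<s])) E s \<longleftrightarrow> stuck p n (cantor_name x) E s"
  by (rule stuck_cong) (rule pad_prefix)

lemma sets_failure: "failure p n i \<in> sets cantor_measure"
proof -
  have "failure p n i = (\<Union>s\<in>{s. lft s = i}. {x. stuck p n (pad (map x [0..<s])) UNIV s})"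
    by (auto simp: failure_def stuck_pad)
  also have "\<dots> \<in> sets cantor_measure"
  proof (rule sets.countable_UN'')
    show "{x. stuck p n (pad (map x [0..<s])) UNIV s} \<in> sets cantor_measure"
      if "s \<in> {s. lft s = i}" for s
      by (rule sets_prefix[of "\<lambda>w. stuck p n (pad w) UNIV s"])
  qed auto
  finally show ?thesis .
qed

lemma cantor_name_le: "cantor_name x m \<le> 1" by (simp add: cantor_name_def)

text \<open>
  Instead of conditioning on the bits outside row \<open>i\<close>, the failure set is translated by all patterns
  on the \<open>n + i + 2\<close> bits that make up the threshold. The translates have equal measure, and they are
  disjoint as at most one threshold is fatal.
\<close>

lemma measure_failure: "measure cantor_measure (failure p n i) \<le> (1/2) ^ (n + i + 2)"
proof -
  define V where "V = (`) (\<lambda>j. \<langle>i, j\<rangle>) ` Pow {..<n + i + 2}"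
  have inj: "inj (\<lambda>j. \<langle>i, j\<rangle>)" by (auto simp: inj_def)
  have card: "card V = 2 ^ (n + i + 2)" unfolding V_def
    by (subst card_image) (auto intro!: inj_onI dest: inj_image_eq_iff[OF inj, THEN iffD1] simp: card_Pow)
  have "real (card V) * measure cantor_measure (failure p n i) \<le> 1"
  proof (rule measure_disjoint_flips[OF sets_failure])
    fix S S' x
    assume S: "S \<in> V" and S': "S' \<in> V" and x: "flip S x \<in> failure p n i" "flip S' x \<in> failure p n i"
    let ?X = "cantor_name (flip S x)" and ?Y = "cantor_name (flip S' x)"
    have eq: "?X m = ?Y m \<longleftrightarrow> (m \<in> S \<longleftrightarrow> m \<in> S')" for m
      by (auto simp: cantor_name_def flip_def)
    have agree: "?X \<langle>i', j\<rangle> = ?Y \<langle>i', j\<rangle>" if "i' \<noteq> i" for i' j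
      using that S S' unfolding eq V_def by auto
    obtain s s' where s: "stuck p n ?X UNIV s" "lft s = i" and s': "stuck p n ?Y UNIV s'" "lft s' = i"
      using x unfolding failure_def by blast
    have "\<not> threshold n ?X i < threshold n ?Y i"
      by (rule notI, rule stuck_unique[OF _ s s']) (rule agree)
    moreover have "\<not> threshold n ?Y i < threshold n ?X i"
      by (rule notI, rule stuck_unique[OF _ s' s]) (rule agree[symmetric])
    ultimately have "threshold n ?X i = threshold n ?Y i" by simp
    then have "\<langle>i, j\<rangle> \<in> S \<longleftrightarrow> \<langle>i, j\<rangle> \<in> S'" if "j < n + i + 2" for j
      using threshold_inj[of n ?X i ?Y j] that cantor_name_le unfolding eq[symmetric] by blast
    with S S' show "S = S'" unfolding V_def by auto
  qed (simp add: V_def)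
  then show ?thesis unfolding card by (simp add: field_simps power_divide)
qed

lemma measure_never_stuck:
  "measure cantor_measure {x. \<forall>s. \<not> stuck p n (cantor_name x) UNIV s} > 1 - 1 / 2 ^ n"
proof -
  have sums: "(\<lambda>i. (1/2) ^ (n + i + 2) :: real) sums ((1/2) ^ (n + 1))"
    using sums_mult[OF geometric_sums[of "1/2 :: real"], of "(1/2) ^ (n + 2)"]
    by (simp add: power_add mult_ac)
  have le: "summable (\<lambda>i. measure cantor_measure (failure p n i))"
    by (rule summable_comparison_test'[OF sums_summable[OF sums]]) (use measure_failure in simp)
  have "measure cantor_measure (\<Union>i. failure p n i) \<le> (\<Sum>i. measure cantor_measure (failure p n i))"
    by (rule cantor.finite_measure_subadditive_countably) (use le sets_failure in auto)
  also have "\<dots> \<le> (\<Sum>i. (1/2) ^ (n + i + 2))"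
    by (rule suminf_le[OF measure_failure le sums_summable[OF sums]])
  also have "\<dots> = (1/2) ^ (n + 1)" using sums by (rule sums_unique[symmetric])
  also have "\<dots> < 1 / 2 ^ n" by (simp add: field_simps power_divide)
  finally have "measure cantor_measure (\<Union>i. failure p n i) < 1 / 2 ^ n" .
  moreover have "{x. \<forall>s. \<not> stuck p n (cantor_name x) UNIV s} = space cantor_measure - (\<Union>i. failure p n i)"
    by (auto simp: failure_def)
  moreover have "(\<Union>i. failure p n i) \<in> sets cantor_measure" using sets_failure by auto
  ultimately show ?thesis using cantor.prob_compl by simp
qed

section \<open>The reduction\<close>
definition tree :: "baire \<Rightarrow> nat \<Rightarrow> bool list set" where
  "tree p n = {w. unstuck p n (pad w) UNIV (length w)}"

lemma binary_tree_tree: "binary_tree (tree p n)"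
  unfolding binary_tree_def tree_def
proof clarify
  fix v w assume "unstuck p n (pad (v @ w)) UNIV (length (v @ w))"
  then have "unstuck p n (pad (v @ w)) UNIV (length v)" by (rule unstuck_mono) simp
  moreover have "unstuck p n (pad (v @ w)) UNIV (length v) \<longleftrightarrow> unstuck p n (pad v) UNIV (length v)"
    by (rule unstuck_cong) (simp add: pad_def nth_append)
  ultimately show "unstuck p n (pad v) UNIV (length v)" by simp
qed

lemma tree_paths_tree: "tree_paths (tree p n) = {x. \<forall>s. \<not> stuck p n (cantor_name x) UNIV s}"
proof -
  have "unstuck p n (pad (map x [0..<s])) UNIV s \<longleftrightarrow> unstuck p n (cantor_name x) UNIV s" for x s
    by (rule unstuck_cong) (rule pad_prefix)
  then show ?thesis by (auto simp: tree_paths_def tree_def unstuck_def)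
qed

text \<open>
  If \<open>m\<close> is the position of the word \<open>w\<close> in the length-lexicographic order, then the binary expansion of \<open>m + 1\<close> is
  \<open>1\<close> followed by \<open>w\<close>, most significant digit first. This recovers \<open>w\<close> from \<open>m\<close>.
\<close>

definition code_length :: "nat \<Rightarrow> nat" where
  "code_length m = bounded_least (\<lambda>l. Suc m < 2 ^ Suc l) (Suc m)"

definition code_bits :: "nat \<Rightarrow> baire" where
  "code_bits m j = of_bool (j < code_length m \<and> bit (Suc m) (code_length m - Suc j))"

lemma code_length: "code_length (word_index w) = length w"
proof -
  have "2 ^ length w \<le> Suc (word_index w) \<and> Suc (word_index w) < 2 ^ Suc (length w)"
  proof (induction w rule: rev_induct)
    case (snoc b w)
    then show ?case by (cases b) (simp_all add: word_index_snoc)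
  qed (simp add: word_index_def)
  then have lower: "2 ^ length w \<le> Suc (word_index w)" and upper: "Suc (word_index w) < 2 ^ Suc (length w)"
    by auto
  have "(LEAST l. Suc (word_index w) < 2 ^ Suc l) = length w"
  proof (rule Least_equality)
    fix l assume "Suc (word_index w) < 2 ^ Suc l"
    with lower have "(2::nat) ^ length w < 2 ^ Suc l" by linarith
    then show "length w \<le> l" by (simp del: power_Suc)
  qed (rule upper)
  moreover have "length w < Suc (word_index w)" using lower less_exp[of "length w"] by linarith
  ultimately show ?thesis using upper unfolding code_length_def bounded_least_def by auto
qed

lemma bit_word_index: "j < length w \<Longrightarrow> bit (Suc (word_index w)) (length w - Suc j) = w ! j"
proof (induction w rule: rev_induct)
  case (snoc b w)
  have eq: "Suc (word_index (w @ [b])) = of_bool b + 2 * Suc (word_index w)"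
    by (simp add: word_index_snoc)
  show ?case
  proof (cases "j = length w")
    case True
    then show ?thesis unfolding eq by (simp add: bit_0)
  next
    case False
    with snoc.prems have j: "j < length w" by simp
    then have "length (w @ [b]) - Suc j = Suc (length w - Suc j)" by simp
    then show ?thesis unfolding eq using snoc.IH[OF j] j by (simp add: bit_Suc nth_append)
  qed
qed simp

lemma code_bits: "code_bits (word_index w) = pad w"
  by (rule ext) (auto simp: code_bits_def pad_def code_length bit_word_index)

lemma recursive_code_length [recursive_intros]:
  assumes "recursive f" shows "recursive (\<lambda>r z. code_length (f r z))"
  unfolding code_length_def by (intro recursive_intros assms recursive_app[OF assms])

lemma recursive_code_bits [recursive_intros]:
  assumes "recursive f" "recursive g" shows "recursive (\<lambda>r z. code_bits (f r z) (g r z))"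
  unfolding code_bits_def by (intro recursive_intros assms)

lemma computable_baireI:
  assumes "\<And>p q n. F p = Some q \<Longrightarrow> ocode_eval c p n = Some (q n)" shows "computable_baire F"
  unfolding computable_baire_def phi_def
  by (rule exI[of _ "ocode_index c"]) (simp add: inv_f_f[OF inj_ocode_index] assms)

text \<open>
  The number \<open>m\<close> codes the index of a tree together with the position of a word.
\<close>

definition in_tree :: "baire \<Rightarrow> nat set \<Rightarrow> nat \<Rightarrow> bool" where
  "in_tree p E m \<longleftrightarrow> unstuck p (lft m) (code_bits (rgt m)) E (code_length (rgt m))"

text \<open>
  The forward reduction. In row \<open>t\<close> of this name stand the approximations with fuel \<open>t\<close> to all
  trees at once.
\<close>

definition trees_name :: "baire \<Rightarrow> baire" where
  "trees_name p m = of_bool (in_tree p {..<lft m} (rgt m))"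

lemma computable_trees_name: "computable_baire (\<lambda>p. Some (trees_name p))"
proof -
  have "recursive trees_name" unfolding trees_name_def[abs_def] in_tree_def
    by (intro recursive_intros decidable_unstuck)
  then obtain c where "\<And>r z. ocode_eval c r z = Some (trees_name r z)" by (rule recursiveE) blast
  then show ?thesis by (intro computable_baireI[of _ c]) auto
qed

lemma LIMSEQ_baireI:
  fixes f :: "nat \<Rightarrow> baire"
  assumes "\<And>k. eventually (\<lambda>t. f t k = l k) sequentially"
  shows "f \<longlonglongrightarrow> l"
proof -
  have "limitin (product_topology (\<lambda>i. euclidean) UNIV) f l sequentially"
    unfolding limitin_componentwise using assms by (auto intro: tendsto_eventually)
  then show ?thesis by (simp add: euclidean_product_topology)
qed

lemma baire_lim_trees_name: "baire_lim (trees_name p) = Some (\<lambda>m. of_bool (in_tree p UNIV m))"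
  unfolding baire_lim_eq_Some_iff
proof (rule LIMSEQ_baireI)
  fix m
  have "eventually (\<lambda>t. in_tree p {..<t} m = in_tree p UNIV m) sequentially"
  proof (cases "in_tree p UNIV m")
    case True
    then show ?thesis using unstuck_fuel unfolding in_tree_def eventually_sequentially by auto
  next
    case False
    then show ?thesis using unstuck_fuel_run unfolding in_tree_def by (auto intro: always_eventually)
  qed
  then show "eventually (\<lambda>t. baire_row (trees_name p) t m = of_bool (in_tree p UNIV m)) sequentially"
    by (rule eventually_mono) (simp add: baire_row_def trees_name_def)
qed

lemma tree_rep_tree: "tree_rep (baire_row (\<lambda>m. of_bool (in_tree p UNIV m)) n) = Some (tree p n)"
proof -
  have "{w. baire_row (\<lambda>m. of_bool (in_tree p UNIV m)) n (word_index w) = 1} = tree p n"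
    by (simp add: baire_row_def in_tree_def code_bits code_length tree_def)
  moreover have "range (baire_row (\<lambda>m. of_bool (in_tree p UNIV m)) n) \<subseteq> {0, 1}"
    by (auto simp: baire_row_def)
  ultimately show ?thesis by (simp add: tree_rep_def binary_tree_tree)
qed

lemma in_rep_trees_name: "in_rep (jump one_minus_star_WWKL) (trees_name p) = Some (tree p)"
  by (auto simp: jump_def one_minus_star_WWKL_def map_comp_def baire_lim_trees_name seq_rep_def
      tree_rep_tree)

lemma mvfun_trees:
  "mvfun (jump one_minus_star_WWKL) (tree p) = Some (SIGMA n:UNIV. tree_paths (tree p n))"
  using measure_never_stuck[of _ p]
  by (simp add: jump_def one_minus_star_WWKL_def eps_WWKL_def dom_def binary_tree_tree tree_paths_tree)

lemma coproduct_rep_SomeD: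
  assumes "coproduct_rep (\<lambda>_. cantor_rep) q = Some (n, x)"
  shows "q 0 = n" "q \<circ> Suc = cantor_name x"
proof -
  from assms show "q 0 = n" by (auto simp: coproduct_rep_def)
  from assms have "cantor_rep (q \<circ> Suc) = Some x" by (auto simp: coproduct_rep_def)
  then have x: "range (q \<circ> Suc) \<subseteq> {0, 1}" "x = (\<lambda>n. (q \<circ> Suc) n = 1)"
    by (auto simp: cantor_rep_def split: if_splits)
  have "(q \<circ> Suc) m \<in> {0, 1}" for m using x(1) by blast
  then show "q \<circ> Suc = cantor_name x" unfolding x(2) cantor_name_def by (auto simp: fun_eq_iff)
qed

lemma cantor_rep_SomeD: "cantor_rep p = Some x \<Longrightarrow> p = cantor_name x"
proof -
  assume "cantor_rep p = Some x"
  then have x: "range p \<subseteq> {0, 1}" "x = (\<lambda>n. p n = 1)"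
    by (auto simp: cantor_rep_def split: if_splits)
  have "p m \<in> {0, 1}" for m using x(1) by blast
  then show "p = cantor_name x" unfolding x(2) cantor_name_def by (auto simp: fun_eq_iff)
qed

lemma cantor_rep_cantor_name: "cantor_rep (cantor_name x) = Some x"
  by (auto simp: cantor_rep_def cantor_name_def)

text \<open>
  The backward reduction. In \<open>\<langle>p, q\<rangle>\<close>, where \<open>q\<close> is \<open>n\<close> followed by \<open>X\<close>, the number \<open>n\<close> is at position
  \<open>1\<close> and \<open>X k\<close> is at position \<open>2 * k + 3\<close>.
\<close>

definition generic_from :: "baire \<rightharpoonup> baire" where
  "generic_from r =
    (let p = (\<lambda>k. r (2 * k)); n = r 1; X = (\<lambda>k. r (2 * k + 3)) in
     if \<forall>s. \<not> stuck p n X UNIV s then Some (cantor_name (generic p n X)) else None)"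

lemma generic_from_pair:
  assumes "q 0 = n" "q \<circ> Suc = X" "\<And>s. \<not> stuck p n X UNIV s"
  shows "generic_from (baire_pair p q) = Some (cantor_name (generic p n X))"
proof -
  have "baire_pair p q 1 = n" by (simp add: baire_pair_def assms(1))
  moreover have "(\<lambda>k. baire_pair p q (2 * k)) = p" by (simp add: baire_pair_def)
  moreover have "baire_pair p q (2 * k + 3) = X k" for k
  proof -
    have "odd (2 * k + 3)" "(2 * k + 3) div 2 = Suc k" by presburger+
    then show ?thesis by (simp add: baire_pair_def flip: assms(2))
  qed
  ultimately show ?thesis unfolding generic_from_def Let_def using assms(3) by presburger
qed

lemma computable_generic_from: "computable_baire generic_from"
proof -
  let ?p = "\<lambda>r k. r (2 * k) :: nat" and ?n = "\<lambda>r. r 1" and ?X = "\<lambda>r k. r (2 * k + 3)"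
  let ?P = "\<lambda>r j t. unstuck (?p r) (?n r) (?X r) {..<t} (Suc j)"
    and ?f = "\<lambda>r j t. of_bool (bit (rgt (cond (?p r) (?n r) (?X r) {..<t} (Suc j))) j)"
  have "decidable (\<lambda>r y. ?P r (lft y) (rgt y))"
    by (intro recursive_intros decidable_unstuck)
  moreover have "recursive (\<lambda>r y. ?f r (lft y) (rgt y))"
    by (intro recursive_intros recursive_run)
  ultimately obtain c where c:
    "\<And>r j. \<exists>t. ?P r j t \<Longrightarrow> ocode_eval c r j = Some (?f r j (LEAST t. ?P r j t))"
    using recursive_Least[of ?P ?f] by blast
  show ?thesis
  proof (rule computable_baireI)
    fix r g j assume "generic_from r = Some g"
    then have never: "\<And>s. \<not> stuck (?p r) (?n r) (?X r) UNIV s"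
      and g: "g = cantor_name (generic (?p r) (?n r) (?X r))"
      by (auto simp: generic_from_def Let_def split: if_splits)
    have "unstuck (?p r) (?n r) (?X r) UNIV (Suc j)" using never unfolding unstuck_def by blast
    then have ex: "\<exists>t. ?P r j t" using unstuck_fuel by blast
    then have "?P r j (LEAST t. ?P r j t)" by (rule LeastI_ex)
    then have "run (?p r) (?n r) (?X r) {..<(LEAST t. ?P r j t)} (Suc j) = run (?p r) (?n r) (?X r) UNIV (Suc j)"
      using unstuck_fuel_run by blast
    then show "ocode_eval c r j = Some (g j)"
      unfolding c[OF ex] g cantor_name_def generic_def by simp
  qed
qed

theorem theorem10p7: "one_GEN \<le>\<^sub>W jump one_minus_star_WWKL"
  unfolding weihrauch_le_def
proof (intro exI conjI allI impI)
  show "computable_baire (\<lambda>p. Some (trees_name p))" by (rule computable_trees_name)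
  show "computable_baire generic_from" by (rule computable_generic_from)
  fix G assume G: "G \<turnstile>\<^sub>R jump one_minus_star_WWKL"
  show "generic_from \<circ>\<^sub>m (\<lambda>p. map_option (baire_pair p) ((G \<circ>\<^sub>m (\<lambda>p. Some (trees_name p))) p)) \<turnstile>\<^sub>R one_GEN"
    unfolding realizes_def
  proof (intro allI impI)
    fix p x S assume "in_rep one_GEN p = Some x \<and> mvfun one_GEN x = Some S"
    then have p: "p = cantor_name x" and S: "S = {y. one_generic_in y x}"
      by (auto simp: one_GEN_def dest: cantor_rep_SomeD)
    obtain q n y where q: "G (trees_name p) = Some q" "out_rep (jump one_minus_star_WWKL) q = Some (n, y)"
      and "(n, y) \<in> (SIGMA n:UNIV. tree_paths (tree p n))"
      using G in_rep_trees_name mvfun_trees unfolding realizes_def by (metis surj_pair)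
    then have never: "\<not> stuck p n (cantor_name y) UNIV s" for s
      by (simp add: tree_paths_tree)
    have "coproduct_rep (\<lambda>_. cantor_rep) q = Some (n, y)"
      using q(2) by (simp add: jump_def one_minus_star_WWKL_def)
    from generic_from_pair[OF coproduct_rep_SomeD[OF this] never]
    have "(generic_from \<circ>\<^sub>m (\<lambda>p. map_option (baire_pair p) ((G \<circ>\<^sub>m (\<lambda>p. Some (trees_name p))) p))) p =
      Some (cantor_name (generic p n (cantor_name y)))"
      by (simp add: map_comp_def q(1))
    moreover have "generic p n (cantor_name y) \<in> S"
      unfolding S using one_generic_if_never_stuck[OF never p] by simp
    ultimately show "\<exists>q y. (generic_from \<circ>\<^sub>m (\<lambda>p. map_option (baire_pair p) ((G \<circ>\<^sub>m (\<lambda>p. Some (trees_name p))) p))) p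
        = Some q \<and> out_rep one_GEN q = Some y \<and> y \<in> S"
      by (simp add: one_GEN_def cantor_rep_cantor_name)
  qed
qed

end
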